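(* Let $\boldsymbol{p}\in(0,1)^d$. Suppose that there exists a partition $(\Lambda_1,\dots,\Lambda_D)$ of $\{1,\dots,d\}$ into sets of cardinalities $(\lambda_1,\dots,\lambda_D)$ such that, for all $h\in\{1,\dots,D\}$, $p_j=\tilde p_h\le\frac{1}{\lambda_h}$ for every $j\in\Lambda_h$. For every $h\in\{1,\dots,D\}$, let $\boldsymbol{K}_h=(K_{h,j})_{j\in\Lambda_h}$ be a random vector in the Fréchet class $\mathcal{B}_{\lambda_h}(\frac1{\lambda_h})$ whose distribution is the lower Fréchet bound of $\mathcal{B}_{\lambda_h}(\frac1{\lambda_h})$. Let $\boldsymbol{I}^H=(I^H_1,\dots,I^H_D)$ be the maximum entropy $D$-dimensional Bernoulli random vector of $\mathcal{B}_D^{\Sigma}(\lambda_1\tilde p_1,\dots,\lambda_D\tilde p_D)$, and assume that $\boldsymbol{K}_1,\dots,\boldsymbol{K}_D$ and $\boldsymbol{I}^H$ are independent. Then the random vector $\boldsymbol{J}=(\boldsymbol{J}_1,\dots,\boldsymbol{J}_D)$, where, for every $h\in\{1,\dots,D\}$, $$\boldsymbol{J}_h=I^H_h\boldsymbol{K}_h$$ (the components of $\boldsymbol{J}_h$ being the components of $\boldsymbol{J}$ with indices $j\in\Lambda_h$), has distribution in the class $\mathcal{B}_d(\boldsymbol{p})$ and satisfies both the strongly Rayleigh and the $\Sigma$-countermonotonicity properties.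
   Context: $\mathcal{B}_d(\boldsymbol{p})=\mathcal{B}_d(p_1,\dots,p_d)$ is the Fréchet class of probability mass functions (pmfs) on $\{0,1\}^d$ whose $j$-th one-dimensional marginal is Bernoulli with mean $p_j$, $j=1,\dots,d$; $\mathcal{B}_d(p)=\mathcal{B}_d(p,\dots,p)$ for a scalar $p$. One writes $\boldsymbol{I}\in\mathcal{B}_d(\boldsymbol{p})$ for a random vector with pmf in the class. Lower Fréchet bound of $\mathcal{B}_d(\boldsymbol{p})$: the function $F_L(i_1,\dots,i_d)=\max(F_1(i_1)+\dots+F_d(i_d)-d+1,0)$ on $\{0,1\}^d$, where $F_j$ is the cdf of the Bernoulli distribution with mean $p_j$; it is the joint cdf of an element of $\mathcal{B}_d(\boldsymbol{p})$ whenever $\sum_j p_j\le1$. Two real random variables $X,Y$ on a probability space $(\Omega,\mathcal{F},\mathbb{P})$ are countermonotonic if $(X(\omega)-X(\omega'))(Y(\omega)-Y(\omega'))\le 0$ for $(\mathbb{P}\times\mathbb{P})$-almost every $(\omega,\omega')\in\Omega^2$. A Bernoulli random vector $\boldsymbol{I}=(I_1,\dots,I_d)$ is $\Sigma$-countermonotonic if for every $\Lambda\subseteq\{1,\dots,d\}$ the random variables $\sum_{j\in\Lambda}I_j$ and $\sum_{j\notin\Lambda}I_j$ are countermonotonic (with $\sum_{j\in\varnothing}I_j=0$). $\mathcal{B}_d^{\Sigma}(\boldsymbol{p})$ is the set of $\Sigma$-countermonotonic elements of $\mathcal{B}_d(\boldsymbol{p})$. Entropy: $H(f)=-\sum_{\boldsymbol{i}\in\{0,1\}^d}f(\boldsymbol{i})\ln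 f(\boldsymbol{i})$, with $0\ln0=0$. The maximum entropy vector of $\mathcal{B}_D^{\Sigma}(\boldsymbol{q})$ is the Bernoulli vector whose pmf maximizes $H$ over $\mathcal{B}_D^{\Sigma}(\boldsymbol{q})$. Strongly Rayleigh: $\boldsymbol{I}$ satisfies the strongly Rayleigh property if its probability generating function $\mathcal{P}_{\boldsymbol{I}}(z_1,\dots,z_d)=E[\prod_{j=1}^d z_j^{I_j}]$ is real stable, i.e. $\mathcal{P}_{\boldsymbol{I}}(z_1,\dots,z_d)\ne0$ whenever all $z_j\in\mathbb{C}$ have strictly positive imaginary part. *)

theory Defs
  imports "HOL-Probability.Probability"
begin

text \<open>
  A vector of \<open>{0,1}\<^sup>A\<close> over a finite index set \<open>A\<close> is an element of
  \<open>A \<rightarrow>\<^sub>E {0,1}\<close>, i.e. a function that is \<open>undefined\<close> outside \<open>A\<close>.  A pmf on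
  \<open>{0,1}\<^sup>A\<close> is a pmf on all functions whose support lies in that set.
\<close>

definition bernoulli01 :: "real \<Rightarrow> nat pmf" where
  "bernoulli01 q = map_pmf of_bool (bernoulli_pmf q)"

text \<open>
  \<^const>\<open>bernoulli_pmf\<close> truncates its parameter to the unit interval; the condition on
  \<open>p\<close> makes the class empty when some \<open>p j\<close> is not the mean of a Bernoulli variable.
\<close>

definition frechet_class :: "'i set \<Rightarrow> ('i \<Rightarrow> real) \<Rightarrow> ('i \<Rightarrow> nat) pmf set" where
  "frechet_class A p = {f. set_pmf f \<subseteq> (A \<rightarrow>\<^sub>E {0, 1}) \<and>
     (\<forall>j\<in>A. p j \<in> {0..1} \<and> map_pmf (\<lambda>x. x j) f = bernoulli01 (p j))}"

definition joint_cdf :: "'i set \<Rightarrow> ('i \<Rightarrow> nat) pmf \<Rightarrow> ('i \<Rightarrow> nat) \<Rightarrow> real" where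
  "joint_cdf A f i = measure_pmf.prob f {x. \<forall>j\<in>A. x j \<le> i j}"

definition lower_frechet_fun :: "'i set \<Rightarrow> ('i \<Rightarrow> real) \<Rightarrow> ('i \<Rightarrow> nat) \<Rightarrow> real" where
  "lower_frechet_fun A p i =
     max ((\<Sum>j\<in>A. measure_pmf.prob (bernoulli01 (p j)) {..i j}) - real (card A) + 1) 0"

definition is_lower_frechet_bound :: "'i set \<Rightarrow> ('i \<Rightarrow> real) \<Rightarrow> ('i \<Rightarrow> nat) pmf \<Rightarrow> bool" where
  "is_lower_frechet_bound A p f \<longleftrightarrow> f \<in> frechet_class A p \<and>
     (\<forall>i \<in> A \<rightarrow>\<^sub>E {0, 1}. joint_cdf A f i = lower_frechet_fun A p i)"

definition countermonotonic :: "'w measure \<Rightarrow> ('w \<Rightarrow> real) \<Rightarrow> ('w \<Rightarrow> real) \<Rightarrow> bool" where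
  "countermonotonic M X Y \<longleftrightarrow>
     (AE (\<omega>, \<omega>') in M \<Otimes>\<^sub>M M. (X \<omega> - X \<omega>') * (Y \<omega> - Y \<omega>') \<le> 0)"

definition sigma_countermonotonic :: "'w measure \<Rightarrow> 'i set \<Rightarrow> ('i \<Rightarrow> 'w \<Rightarrow> nat) \<Rightarrow> bool" where
  "sigma_countermonotonic M A X \<longleftrightarrow>
     (\<forall>L \<subseteq> A. countermonotonic M (\<lambda>\<omega>. \<Sum>j\<in>L. real (X j \<omega>)) (\<lambda>\<omega>. \<Sum>j\<in>A - L. real (X j \<omega>)))"

text \<open>
  \<open>\<Sigma>\<close>-countermonotonicity depends only on the distribution, so for a pmf it is read off
  from the coordinate vector on the probability space given by that pmf.
\<close>

definition sigma_frechet_class :: "'i set \<Rightarrow> ('i \<Rightarrow> real) \<Rightarrow> ('i \<Rightarrow> nat) pmf set" where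
  "sigma_frechet_class A p =
     {f \<in> frechet_class A p. sigma_countermonotonic (measure_pmf f) A (\<lambda>j x. x j)}"

text \<open>The convention \<open>0 ln 0 = 0\<close> is built in, since \<open>ln 0 = 0\<close> for real numbers.\<close>

definition pmf_entropy :: "'i set \<Rightarrow> ('i \<Rightarrow> nat) pmf \<Rightarrow> real" where
  "pmf_entropy A f = - (\<Sum>i \<in> A \<rightarrow>\<^sub>E {0, 1}. pmf f i * ln (pmf f i))"

definition random_vector :: "'i set \<Rightarrow> ('i \<Rightarrow> 'w \<Rightarrow> nat) \<Rightarrow> 'w \<Rightarrow> 'i \<Rightarrow> nat" where
  "random_vector A X \<omega> = (\<lambda>j\<in>A. X j \<omega>)"

text \<open>
  For finite \<open>A\<close> the vector takes countably many values, so measurability with respect to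
  the discrete sigma-algebra is the same as measurability of all components.
\<close>

definition has_pmf :: "'w measure \<Rightarrow> 'i set \<Rightarrow> ('i \<Rightarrow> 'w \<Rightarrow> nat) \<Rightarrow> ('i \<Rightarrow> nat) pmf \<Rightarrow> bool" where
  "has_pmf M A X f \<longleftrightarrow> random_vector A X \<in> M \<rightarrow>\<^sub>M count_space UNIV \<and>
     distr M (count_space UNIV) (random_vector A X) = measure_pmf f"

definition pgf :: "'w measure \<Rightarrow> 'i set \<Rightarrow> ('i \<Rightarrow> 'w \<Rightarrow> nat) \<Rightarrow> ('i \<Rightarrow> complex) \<Rightarrow> complex" where
  "pgf M A X z = (\<integral>\<omega>. (\<Prod>j\<in>A. z j ^ X j \<omega>) \<partial>M)"

definition strongly_rayleigh :: "'w measure \<Rightarrow> 'i set \<Rightarrow> ('i \<Rightarrow> 'w \<Rightarrow> nat) \<Rightarrow> bool" where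
  "strongly_rayleigh M A X \<longleftrightarrow> (\<forall>z. (\<forall>j\<in>A. Im (z j) > 0) \<longrightarrow> pgf M A X z \<noteq> 0)"

end

theory Submission
  imports Defs
begin

text \<open>
  Strong Rayleighness of the blown-up vector \<open>J\<close> reduces to that of \<open>I\<^sup>H\<close>.  A vector \<open>K\<^sub>h\<close> whose
  law is the lower Frechet bound with all means \<open>1 / \<lambda>\<^sub>h\<close> has exactly one coordinate equal to one,
  in a uniformly distributed place (\<open>lower_frechet_bound_one_hot\<close>).  By independence the generating
  function of \<open>J\<close> at \<open>z\<close> is therefore the one of \<open>I\<^sup>H\<close> at the block means of \<open>z\<close>
  (\<open>expectation_selected_product\<close>, \<open>lower_frechet_bound_pgf\<close>), and a mean of points of the upper
  half-plane lies in it.  Likewise the coordinate sum of \<open>J\<close> equals that of \<open>I\<^sup>H\<close> almost surely.  A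
  Bernoulli vector is \<open>\<Sigma>\<close>-countermonotonic exactly when its sum takes at most two consecutive values
  \<open>k\<close>, \<open>k + 1\<close> (\<open>sigma_countermonotonic_if_consecutive_sums\<close> and
  \<open>consecutive_sums_if_sigma_countermonotonic\<close>), so the property passes from \<open>I\<^sup>H\<close> to \<open>J\<close>.

  It remains to see that the maximum entropy law is strongly Rayleigh (\<open>max_entropy_pgf_nonzero\<close>).
  Let \<open>x + y = x' + y'\<close> with all four vectors in the two layers \<open>k\<close>, \<open>k + 1\<close>.  Shifting a little
  mass from \<open>x\<close>, \<open>y\<close> to \<open>x'\<close>, \<open>y'\<close> stays in the class, so a maximizer \<open>f\<close> satisfies
  \<open>f x * f y \<le> f x' * f y'\<close> whenever \<open>x\<close> and \<open>y\<close> are in its support (\<open>max_entropy_exchange_le\<close>), and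
  then equality by symmetry.  A slack coordinate merges the two layers into the subsets of one fixed
  size.  A weight on such subsets with this exchange property is a product of element weights, apart
  from coordinates that are almost surely constant (\<open>exchange.product_form\<close>).  The generating
  function is thus, up to a monomial, an elementary symmetric polynomial in positively rescaled
  variables with the slack variable set to one.  Elementary symmetric polynomials have no zeros there,
  because the quotients of consecutive ones map the upper half-plane into itself
  (\<open>esym_ratio_upper_half_plane\<close>).  This exchange argument works for all values of the means,
  including the boundary case \<open>\<lambda>\<^sub>h * p\<^sub>h = 1\<close>.
\<close>

section \<open>Elementary symmetric polynomials on the upper half-plane\<close>

text \<open>
  The elementary symmetric polynomial of degree \<open>s\<close> in the variables indexed by \<open>N\<close>.
\<close>

definition esym :: "'a set \<Rightarrow> nat \<Rightarrow> ('a \<Rightarrow> 'b::comm_ring_1) \<Rightarrow> 'b" where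
  "esym N s x = (\<Sum>T | T \<subseteq> N \<and> card T = s. \<Prod>i\<in>T. x i)"

lemma esym_0:
  assumes "finite N"
  shows "esym N 0 x = 1"
proof -
  have "{T. T \<subseteq> N \<and> card T = 0} = {{}}"
    using assms finite_subset by fastforce
  then show ?thesis by (simp add: esym_def)
qed

lemma esym_insert:
  assumes N: "finite N" "a \<notin> N"
  shows "esym (insert a N) (Suc s) x = esym N (Suc s) x + x a * esym N s x"
proof -
  let ?B = "\<lambda>s. {T. T \<subseteq> N \<and> card T = s}"
  have fin: "finite (?B s)" for s
    using N(1) by simp
  have "{T. T \<subseteq> insert a N \<and> card T = Suc s} = ?B (Suc s) \<union> insert a ` ?B s" (is "?L = ?R")
  proof (intro set_eqI iffI)
    fix T assume T: "T \<in> ?L"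
    then have fT: "finite T" using N(1) finite_subset by fastforce
    show "T \<in> ?R"
    proof (cases "a \<in> T")
      case True
      then have "T = insert a (T - {a})" "T - {a} \<in> ?B s"
        using T fT by auto
      then show ?thesis by blast
    qed (use T in auto)
  next
    fix T assume "T \<in> ?R"
    then show "T \<in> ?L"
      using N finite_subset[OF _ N(1)] by (auto simp: card_insert_if)
  qed
  moreover have "?B (Suc s) \<inter> insert a ` ?B s = {}"
    using N(2) by auto
  moreover have "inj_on (insert a) (?B s)"
    using N(2) by (auto simp: inj_on_def insert_ident subset_iff)
  moreover have "(\<Prod>i\<in>insert a T. x i) = x a * (\<Prod>i\<in>T. x i)" if "T \<in> ?B s" for T
    using that N finite_subset[OF _ N(1)] by (subst prod.insert) auto
  ultimately show ?thesis
    unfolding esym_def using fin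
    by (simp add: sum.union_disjoint sum.reindex sum_distrib_left)
qed

text \<open>
  Euler's identity for a form of degree \<open>s + 1\<close>: the partial derivative with respect to
  \<open>x a\<close> is the polynomial of degree \<open>s\<close> in the remaining variables.  It is the count of pairs of
  a set with one of its elements.
\<close>

lemma esym_Suc_euler:
  assumes N: "finite N"
  shows "of_nat (Suc s) * esym N (Suc s) x = (\<Sum>a\<in>N. x a * esym (N - {a}) s x)"
proof -
  let ?C = "{T. T \<subseteq> N \<and> card T = Suc s}"
  have "of_nat (Suc s) * esym N (Suc s) x = (\<Sum>T\<in>?C. \<Sum>a\<in>T. \<Prod>i\<in>T. x i)"
    by (simp add: esym_def sum_distrib_left)
  also have "\<dots> = (\<Sum>(T, a)\<in>Sigma ?C (\<lambda>T. T). \<Prod>i\<in>T. x i)"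
    using N finite_subset[OF _ N] by (subst sum.Sigma) auto
  also have "\<dots> = (\<Sum>(a, T)\<in>Sigma N (\<lambda>a. {T. T \<subseteq> N - {a} \<and> card T = s}). x a * (\<Prod>i\<in>T. x i))"
  proof (rule sum.reindex_bij_witness[of _ "\<lambda>(a, T). (insert a T, a)" "\<lambda>(T, a). (a, T - {a})"])
    show "(case (case q of (T, a) \<Rightarrow> (a, T - {a})) of (a, T) \<Rightarrow> x a * (\<Prod>i\<in>T. x i)) =
        (case q of (T, a) \<Rightarrow> \<Prod>i\<in>T. x i)" if "q \<in> Sigma ?C (\<lambda>T. T)" for q
      using that N finite_subset[OF _ N] by (auto simp: prod.remove)
    show "(case q of (a, T) \<Rightarrow> (insert a T, a)) \<in> Sigma ?C (\<lambda>T. T)"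
      if "q \<in> Sigma N (\<lambda>a. {T. T \<subseteq> N - {a} \<and> card T = s})" for q
    proof -
      obtain a T where q: "q = (a, T)" by (cases q)
      then have "finite T" "a \<notin> T" "a \<in> N" "T \<subseteq> N" "card T = s"
        using that N by (auto intro: finite_subset)
      then show ?thesis using q by auto
    qed
  qed (use N finite_subset[OF _ N] in auto)
  also have "\<dots> = (\<Sum>a\<in>N. x a * esym (N - {a}) s x)"
    unfolding esym_def sum_distrib_left using N by (subst sum.Sigma) auto
  finally show ?thesis .
qed

text \<open>
  The number is \<open>1 / (1/z + 1/w)\<close>, and inversion exchanges the two open half-planes, each of
  which is closed under addition.
\<close>

lemma Im_parallel_sum_pos:
  assumes "Im z > 0" "Im w > 0"
  shows "Im (z * w / (w + z)) > 0"
proof -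
  have nz: "z \<noteq> 0" "w \<noteq> 0" using assms by auto
  have inv: "Im (inverse u) < 0 \<longleftrightarrow> Im u > 0" if "u \<noteq> 0" for u
  proof -
    have "(Re u)\<^sup>2 + (Im u)\<^sup>2 > 0"
      using that by (simp add: sum_power2_gt_zero_iff complex_eq_iff)
    then show ?thesis
      by (simp add: zero_less_divide_iff not_less[symmetric])
  qed
  have wz: "w + z \<noteq> 0"
  proof
    assume "w + z = 0"
    then have "Im w + Im z = 0" by (metis plus_complex.simps(2) zero_complex.simps(2))
    then show False using assms by linarith
  qed
  have "inverse (z * w / (w + z)) = inverse z + inverse w"
    using nz wz by (simp add: field_simps)
  moreover have "Im (inverse z + inverse w) < 0"
    unfolding plus_complex.simps using inv[of z] inv[of w] nz assms by linarith
  moreover have "z * w / (w + z) \<noteq> 0"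
    using nz wz by simp
  ultimately show ?thesis
    using inv[of "z * w / (w + z)"] by metis
qed

text \<open>
  Stability of the elementary symmetric polynomials, in the form that survives induction on the
  degree.  Euler's identity writes a positive multiple of the quotient of consecutive polynomials as
  a sum over \<open>a\<close>, and the summand is the parallel sum of \<open>x a\<close> with the quotient one degree lower
  in the variables other than \<open>x a\<close>.
\<close>

lemma esym_ratio_upper_half_plane:
  fixes x :: "'a \<Rightarrow> complex"
  assumes "finite N" "s < card N" "\<And>i. i \<in> N \<Longrightarrow> Im (x i) > 0"
  shows "esym N s x \<noteq> 0 \<and> Im (esym N (Suc s) x / esym N s x) > 0"
  using assms
proof (induction s arbitrary: N)
  case 0
  have "esym N (Suc 0) x = (\<Sum>a\<in>N. x a)"
    using esym_Suc_euler[OF 0(1), of 0 x] 0(1) by (simp add: esym_0)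
  moreover have "(\<Sum>a\<in>N. Im (x a)) > 0"
    using 0 by (intro sum_pos) auto
  ultimately show ?case
    using 0(1) by (simp add: esym_0)
next
  case (Suc s)
  let ?e = "esym N (Suc s) x"
  have e: "?e \<noteq> 0"
    using Suc.IH[of N] Suc.prems by auto
  have pos: "Im (x a * esym (N - {a}) (Suc s) x / ?e) > 0" if a: "a \<in> N" for a
  proof -
    let ?f = "esym (N - {a}) s x" and ?g = "esym (N - {a}) (Suc s) x"
    have IH: "?f \<noteq> 0" "Im (?g / ?f) > 0"
      using Suc.IH[of "N - {a}"] Suc.prems a by auto
    have "?e = ?g + x a * ?f"
      using esym_insert[of "N - {a}" a s x] Suc.prems(1) a by (simp add: insert_absorb)
    then have "x a * ?g / ?e = x a * (?g / ?f) / (?g / ?f + x a)"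
      using IH(1) e by (simp add: field_simps)
    then show ?thesis
      using Im_parallel_sum_pos[OF Suc.prems(3)[OF a] IH(2)] by (simp only:)
  qed
  have "of_nat (Suc (Suc s)) * (esym N (Suc (Suc s)) x / ?e)
      = (\<Sum>a\<in>N. x a * esym (N - {a}) (Suc s) x / ?e)"
    unfolding times_divide_eq_right esym_Suc_euler[OF Suc.prems(1)] by (simp add: sum_divide_distrib)
  moreover have "Im \<dots> > 0"
    unfolding Im_sum using pos Suc.prems by (intro sum_pos) auto
  ultimately have "Im (of_nat (Suc (Suc s)) * (esym N (Suc (Suc s)) x / ?e)) > 0"
    by simp
  moreover have "Im (of_nat (Suc (Suc s)) * u) = real (Suc (Suc s)) * Im u" for u
    by (metis Re_complex_of_real Im_complex_of_real complex_Im_of_nat complex_Re_of_nat mult_zero_left add.right_neutral times_complex.simps(2))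
  ultimately have "real (Suc (Suc s)) * Im (esym N (Suc (Suc s)) x / ?e) > 0"
    by (simp only:)
  then have "Im (esym N (Suc (Suc s)) x / ?e) > 0"
    by (rule zero_less_mult_pos) simp
  then show ?case
    using e by blast
qed

lemma esym_nonzero_upper_half_plane:
  fixes x :: "'a \<Rightarrow> complex"
  assumes "finite N" "s \<le> card N" "\<And>i. i \<in> N \<Longrightarrow> Im (x i) > 0"
  shows "esym N s x \<noteq> 0"
proof (cases s)
  case 0
  then show ?thesis using assms(1) by (simp add: esym_0)
next
  case (Suc t)
  then show ?thesis
    using esym_ratio_upper_half_plane[of N t x] assms by auto
qed

text \<open>
  A real variable adds a real number to the quotient of consecutive polynomials in the other
  variables, so its imaginary part stays positive.
\<close>

lemma esym_nonzero_one_real: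
  fixes x :: "'a \<Rightarrow> complex"
  assumes N: "finite N" "a \<notin> N" and s: "s \<le> Suc (card N)"
    and x: "\<And>i. i \<in> N \<Longrightarrow> Im (x i) > 0" and a: "Im (x a) = 0" "x a \<noteq> 0"
  shows "esym (insert a N) s x \<noteq> 0"
proof (cases s)
  case 0
  then show ?thesis using N by (simp add: esym_0)
next
  case (Suc t)
  have t: "esym N t x \<noteq> 0"
    using esym_nonzero_upper_half_plane[of N t x] N s x Suc by simp
  show ?thesis
  proof (cases "t < card N")
    case True
    then have "Im (esym N (Suc t) x / esym N t x + x a) > 0"
      using esym_ratio_upper_half_plane[of N t x] N x a by simp
    then have "esym N (Suc t) x / esym N t x + x a \<noteq> 0"
      by (metis less_irrefl zero_complex.simps(2))
    moreover have "esym N (Suc t) x + x a * esym N t x =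
        (esym N (Suc t) x / esym N t x + x a) * esym N t x"
      using t by (simp add: field_simps)
    ultimately show ?thesis
      using t Suc by (simp add: esym_insert[OF N])
  next
    case False
    then have "{T. T \<subseteq> N \<and> card T = Suc t} = {}"
      by (auto dest!: card_mono[OF N(1)])
    then have "esym N (Suc t) x = 0" by (simp only: esym_def sum.empty)
    then show ?thesis using t a Suc by (simp add: esym_insert[OF N])
  qed
qed

section \<open>Weights on subsets with the exchange property\<close>

definition swap :: "'a \<Rightarrow> 'a \<Rightarrow> 'a set \<Rightarrow> 'a set" where
  "swap j i T = insert i (T - {j})"

lemma swap_id: "j \<in> T \<Longrightarrow> i \<notin> T \<Longrightarrow> swap i j (swap j i T) = T"
  by (auto simp: swap_def)

text \<open>
  A nonnegative weight on the \<open>r\<close>-element subsets of \<open>V\<close> for which trading one element of \<open>T\<close>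
  against one element of \<open>U\<close> never changes the product of the two weights.  A weight that is a
  product over elements has this property, and the point of the locale is the converse.
\<close>

locale exchange =
  fixes F :: "'a set \<Rightarrow> real" and V :: "'a set" and r :: nat
  assumes finite_ground: "finite V"
    and nonneg: "F T \<ge> 0"
    and support: "F T > 0 \<Longrightarrow> T \<subseteq> V \<and> card T = r"
    and exch: "F T > 0 \<Longrightarrow> F U > 0 \<Longrightarrow> i \<in> U - T \<Longrightarrow> j \<in> T - U \<Longrightarrow>
      F (swap j i T) * F (swap i j U) = F T * F U"
begin

text \<open>
  Elements of \<open>fixd\<close> lie in every set of positive weight.  An element is in \<open>free\<close> if both its
  presence and its absence have positive weight; the remaining ones never occur.
\<close>

definition fixd :: "'a set" where "fixd = {i. \<forall>T. F T > 0 \<longrightarrow> i \<in> T}"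
definition free :: "'a set" where "free = {i. \<exists>T. F T > 0 \<and> i \<in> T} - fixd"

lemma finite_free: "finite free"
  using finite_ground support by (auto simp: free_def intro: finite_subset[of _ V])

lemma support_bounds: "F T > 0 \<Longrightarrow> fixd \<subseteq> T \<and> T \<subseteq> fixd \<union> free"
  by (auto simp: fixd_def free_def)

lemma support_finite: "F T > 0 \<Longrightarrow> finite T"
  using support finite_ground finite_subset by blast

lemma exch_pos:
  assumes "F T > 0" "F U > 0" "i \<in> U - T" "j \<in> T - U"
  shows "F (swap j i T) > 0" "F (swap i j U) > 0"
proof -
  have "F (swap j i T) * F (swap i j U) > 0"
    using exch[OF assms] assms(1,2) by simp
  then show "F (swap j i T) > 0" "F (swap i j U) > 0"
    using nonneg[of "swap j i T"] nonneg[of "swap i j U"] by (auto simp: zero_less_mult_iff)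
qed

text \<open>
  If no set that contains \<open>i\<close> avoids \<open>j\<close> at once, one starts from a set \<open>B\<close> that contains both
  and a set \<open>C\<close> that contains neither, and trades \<open>j\<close> for an element of \<open>C\<close>.
\<close>

lemma separating:
  assumes i: "i \<in> free" and j: "j \<in> free" and ij: "i \<noteq> j"
  obtains U where "F U > 0" "i \<in> U" "j \<notin> U"
proof -
  obtain B where B: "F B > 0" "i \<in> B" using i by (auto simp: free_def)
  obtain C where C: "F C > 0" "j \<notin> C" using j by (auto simp: free_def fixd_def)
  show thesis
  proof (cases "j \<in> B \<and> i \<notin> C")
    case True
    \<comment> \<open>Both sets have \<open>r\<close> elements, and only \<open>B\<close> contains \<open>j\<close>.\<close>
    have "\<not> C \<subseteq> B"
      using True C(2) B support[of B] support[of C] C(1) support_finite[OF B(1)] card_subset_eq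
      by metis
    then obtain m where m: "m \<in> C" "m \<notin> B" by auto
    have "F (swap j m B) > 0"
      using exch_pos(1)[OF B(1) C(1), of m j] m True C(2) by auto
    then show thesis
      using that[of "swap j m B"] B m True ij by (auto simp: swap_def)
  qed (use that B C in blast)
qed

lemma swap_pos:
  assumes T: "F T > 0" and i: "i \<in> free - T" and j: "j \<in> free \<inter> T"
  shows "F (swap j i T) > 0"
proof -
  obtain U where "F U > 0" "i \<in> U" "j \<notin> U"
    using separating[of i j] i j by blast
  then show ?thesis using exch_pos(1)[OF T] i j by blast
qed

text \<open>
  The factor by which the weight changes when \<open>i\<close> replaces \<open>j\<close> depends only on \<open>i\<close> and \<open>j\<close>: this
  is the exchange condition for \<open>T\<close> and the set that results from \<open>U\<close>.
\<close>

lemma swap_ratio: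
  assumes T: "F T > 0" "j \<in> T" "i \<notin> T" and U: "F U > 0" "j \<in> U" "i \<notin> U"
    and ij: "i \<in> free" "j \<in> free"
  shows "F (swap j i T) * F U = F T * F (swap j i U)"
proof -
  have "i \<noteq> j" using T by auto
  have U': "F (swap j i U) > 0" using swap_pos[OF U(1)] U ij by blast
  show ?thesis
    using exch[OF T(1) U', of i j] T U \<open>i \<noteq> j\<close> by (simp add: swap_id) (auto simp: swap_def)
qed

text \<open>
  The weight of \<open>i\<close> is the factor of the replacement of a fixed reference element \<open>a\<close> by \<open>i\<close>.
  Every other replacement is the composition of one that brings in \<open>a\<close> and one that removes it.
\<close>

lemma weights:
  obtains w :: "'a \<Rightarrow> real" where "\<And>i. w i > 0"
    "\<And>T i j. F T > 0 \<Longrightarrow> i \<in> free - T \<Longrightarrow> j \<in> free \<inter> T \<Longrightarrow> F (swap j i T) * w j = F T * w i"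
proof (cases "free = {}")
  case True
  then show ?thesis using that[of "\<lambda>_. 1"] by auto
next
  case False
  then obtain a where a: "a \<in> free" by auto
  define R where "R i = (SOME T. F T > 0 \<and> a \<in> T \<and> i \<notin> T)" for i
  have R: "F (R i) > 0 \<and> a \<in> R i \<and> i \<notin> R i" if "i \<in> free" "i \<noteq> a" for i
    unfolding R_def by (rule someI_ex) (metis separating a that)
  define w where "w i = (if i \<in> free - {a} then F (swap a i (R i)) / F (R i) else 1)" for i
  have w: "w i > 0" for i
    using R swap_pos[of "R i" i a] a by (auto simp: w_def)
  have wa: "w i * F T = F (swap a i T)" if "F T > 0" "a \<in> T" "i \<in> free - T" for i T
  proof -
    have "i \<in> free" "i \<noteq> a" using that by auto
    then show ?thesis
      using swap_ratio[of T a i "R i"] R[of i] that a by (simp add: w_def field_simps)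
  qed
  show thesis
  proof (rule that[OF w])
    fix T i j assume T: "F T > 0" and i: "i \<in> free - T" and j: "j \<in> free \<inter> T"
    have ij: "i \<noteq> j" using i j by auto
    consider "j = a" | "i = a" | "i \<noteq> a" "j \<noteq> a" "a \<in> T" | "i \<noteq> a" "j \<noteq> a" "a \<notin> T" by blast
    then show "F (swap j i T) * w j = F T * w i"
    proof cases
      case 1
      then show ?thesis using wa[OF T, of i] i j by (simp add: w_def mult.commute)
    next
      case 2
      have "F (swap j a T) > 0" using swap_pos[OF T i j] 2 by simp
      moreover have "a \<in> swap j a T" "j \<notin> swap j a T" using 2 ij by (auto simp: swap_def)
      moreover have "swap a j (swap j a T) = T" using swap_id[of j T a] 2 i j by auto
      ultimately have "w j * F (swap j a T) = F T"
        using wa[of "swap j a T" j] j by auto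
      then show ?thesis using 2 by (simp add: w_def mult.commute)
    next
      case 3
      have "F (swap j i T) > 0" by (rule swap_pos[OF T i j])
      moreover have "a \<in> swap j i T" "j \<notin> swap j i T" using 3 ij by (auto simp: swap_def)
      moreover have "swap a j (swap j i T) = swap a i T"
        using 3 i j by (auto simp: swap_def)
      ultimately have "w j * F (swap j i T) = F (swap a i T)"
        using wa[of "swap j i T" j] j by auto
      then show ?thesis using wa[OF T 3(3) i] by (simp add: mult.commute)
    next
      case 4
      have pos: "F (swap j a T) > 0" using swap_pos[OF T _ j, of a] a 4 by auto
      have "a \<in> swap j a T" "j \<notin> swap j a T" "i \<notin> swap j a T"
        using 4 ij i by (auto simp: swap_def)
      moreover have "swap a j (swap j a T) = T" "swap a i (swap j a T) = swap j i T"
        using 4 i j by (auto simp: swap_def)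
      ultimately have "w j * F (swap j a T) = F T" "w i * F (swap j a T) = F (swap j i T)"
        using wa[OF pos, of j] wa[OF pos, of i] i j by auto
      then show ?thesis by (metis mult.assoc mult.commute)
    qed
  qed
qed

text \<open>
  All sets of the right size between \<open>fixd\<close> and \<open>fixd \<union> free\<close> are reached from \<open>T0\<close> by single
  replacements, each of which keeps the weight positive and multiplies it by a quotient of element
  weights.
\<close>

lemma product_form:
  assumes T0: "F T0 > 0"
  obtains w :: "'a \<Rightarrow> real" and c :: real where "\<And>i. w i > 0" "c > 0"
    "\<And>T. F T = (if fixd \<subseteq> T \<and> T \<subseteq> fixd \<union> free \<and> card T = r then c * (\<Prod>i\<in>T \<inter> free. w i) else 0)"
proof -
  obtain w :: "'a \<Rightarrow> real" where w: "\<And>i. w i > 0" and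
    ratio: "\<And>T i j. F T > 0 \<Longrightarrow> i \<in> free - T \<Longrightarrow> j \<in> free \<inter> T \<Longrightarrow> F (swap j i T) * w j = F T * w i"
    using weights by metis
  let ?W = "\<lambda>T. \<Prod>i\<in>T \<inter> free. w i"
  have W: "?W T > 0" for T using w by (simp add: prod_pos)
  define c where "c = F T0 / ?W T0"
  have c: "c > 0" using T0 W by (simp add: c_def)
  have main: "F T = c * ?W T"
    if "fixd \<subseteq> T" "T \<subseteq> fixd \<union> free" "card T = r" "finite T" for T
    using that
  proof (induction "card (T - T0)" arbitrary: T)
    case 0
    then have "T \<subseteq> T0" by simp
    then have "T = T0"
      using 0 support[OF T0] support_finite[OF T0] by (simp add: card_subset_eq)
    then show ?case using W[of T0] by (simp add: c_def)
  next
    case (Suc n)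
    have f0: "finite T0" "card T0 = r" using support[OF T0] support_finite[OF T0] by auto
    obtain i where i: "i \<in> T" "i \<notin> T0"
      using Suc(2) by (metis Diff_eq_empty_iff card.empty nat.distinct(1) subsetI)
    have "\<not> T0 \<subseteq> T" using i Suc.prems f0 card_subset_eq[of T T0] by auto
    then obtain j where j: "j \<in> T0" "j \<notin> T" by auto
    have ij: "i \<in> free" "j \<in> free"
      using i j Suc.prems support_bounds[OF T0] by auto
    let ?U = "swap i j T"
    have undo: "swap j i ?U = T" using i j by (auto simp: swap_def)
    have "?U - T0 = (T - T0) - {i}" using i j by (auto simp: swap_def)
    then have "n = card (?U - T0)" using Suc(2) i Suc.prems by simp
    moreover have "fixd \<subseteq> ?U" "?U \<subseteq> fixd \<union> free"
      using Suc.prems ij i by (auto simp: swap_def free_def)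
    moreover have "card ?U = r" "finite ?U"
      using Suc.prems i j card_Suc_Diff1[of T i] by (auto simp: swap_def)
    ultimately have U: "F ?U = c * ?W ?U" by (rule Suc.hyps(1))
    then have "F T * w j = F ?U * w i"
      using ratio[of ?U i j] undo c W[of ?U] ij i j by (auto simp: swap_def)
    moreover have "?W ?U * w i = ?W T * w j"
    proof -
      have "?W T = w i * prod w (T \<inter> free - {i})"
        using prod.remove[of "T \<inter> free" i w] finite_free ij i by simp
      moreover have "?U \<inter> free = insert j (T \<inter> free - {i})"
        using ij i j by (auto simp: swap_def)
      then have "?W ?U = w j * prod w (T \<inter> free - {i})"
        using finite_free j by simp
      ultimately show ?thesis by simp
    qed
    ultimately have "F T * w j = (c * ?W T) * w j" using U by (simp add: mult.assoc)
    then show ?case using w[of j] by simp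
  qed
  have "finite (fixd \<union> free)"
    using finite_free support_bounds[OF T0] support_finite[OF T0] finite_subset by auto
  then have "F T = c * ?W T" if "fixd \<subseteq> T" "T \<subseteq> fixd \<union> free" "card T = r" for T
    using main that finite_subset by blast
  moreover have "F T = 0" if "\<not> (fixd \<subseteq> T \<and> T \<subseteq> fixd \<union> free \<and> card T = r)" for T
    using that support_bounds[of T] support[of T] nonneg[of T] by linarith
  ultimately have "F T = (if fixd \<subseteq> T \<and> T \<subseteq> fixd \<union> free \<and> card T = r then c * ?W T else 0)" for T
    by simp
  then show thesis by (rule that[OF w c])
qed

text \<open>
  By the product form the generating polynomial is a monomial times an elementary symmetric
  polynomial in rescaled variables.  Scaling by positive reals preserves the upper half-plane, and
  the real variable \<open>x a\<close> stays real.
\<close>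

lemma generating_polynomial_nonzero:
  fixes x :: "'a \<Rightarrow> complex"
  assumes T0: "F T0 > 0"
    and x: "\<And>i. i \<in> V - {a} \<Longrightarrow> Im (x i) > 0" and a: "Im (x a) = 0" "x a \<noteq> 0"
  shows "(\<Sum>T\<in>Pow V. of_real (F T) * (\<Prod>i\<in>T. x i)) \<noteq> 0"
proof -
  obtain w c where w: "\<And>i. w i > 0" and c: "c > 0" and
    F: "\<And>T. F T = (if fixd \<subseteq> T \<and> T \<subseteq> fixd \<union> free \<and> card T = r then c * (\<Prod>i\<in>T \<inter> free. w i) else 0)"
    using product_form[OF T0] by metis
  have ff: "fixd \<inter> free = {}" by (auto simp: free_def)
  have sub: "fixd \<subseteq> T0" "T0 \<subseteq> fixd \<union> free" "finite T0" "card T0 = r" "T0 \<subseteq> V"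
    using support_bounds[OF T0] support_finite[OF T0] support[OF T0] by auto
  then have fin: "finite fixd" using finite_subset by auto
  have V: "free \<subseteq> V" "fixd \<subseteq> V"
    using support sub by (auto simp: free_def)
  define s where "s = r - card fixd"
  have card_un: "card (fixd \<union> U) = card fixd + card U" if "U \<subseteq> free" for U
    using that ff fin finite_free by (subst card_Un_disjoint) (auto intro: finite_subset)
  have r: "r = card fixd + s"
    unfolding s_def using card_mono[OF sub(3,1)] sub(4) by simp
  have s: "s \<le> card free"
    using card_mono[OF _ sub(2)] fin finite_free sub(4) card_un[of free] r by simp
  let ?y = "\<lambda>i. of_real (w i) * x i"
  have "(\<Sum>T\<in>Pow V. of_real (F T) * (\<Prod>i\<in>T. x i)) =
      (\<Sum>T | fixd \<subseteq> T \<and> T \<subseteq> fixd \<union> free \<and> card T = r. of_real (F T) * (\<Prod>i\<in>T. x i))"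
    using V finite_ground by (intro sum.mono_neutral_right) (auto simp: F)
  also have "\<dots> = (\<Sum>U | U \<subseteq> free \<and> card U = s. of_real c * (\<Prod>i\<in>fixd. x i) * (\<Prod>i\<in>U. ?y i))"
  proof (rule sum.reindex_bij_witness[of _ "\<lambda>U. fixd \<union> U" "\<lambda>T. T - fixd"])
    fix T assume "T \<in> {T. fixd \<subseteq> T \<and> T \<subseteq> fixd \<union> free \<and> card T = r}"
    then have T: "fixd \<subseteq> T" "T \<subseteq> fixd \<union> free" "card T = r" by auto
    show "fixd \<union> (T - fixd) = T" using T by auto
    have U: "T - fixd \<subseteq> free" "T - fixd = T \<inter> free" using T ff by auto
    show "T - fixd \<in> {U. U \<subseteq> free \<and> card U = s}"
      using U(1) T(3) card_un[OF U(1)] r \<open>fixd \<union> (T - fixd) = T\<close> by simp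
    have "(\<Prod>i\<in>T. x i) = (\<Prod>i\<in>fixd. x i) * (\<Prod>i\<in>T \<inter> free. x i)"
      using T ff fin finite_free
      by (subst prod.union_disjoint[symmetric]) (auto intro!: prod.cong)
    then show "of_real c * (\<Prod>i\<in>fixd. x i) * (\<Prod>i\<in>T - fixd. ?y i) = of_real (F T) * (\<Prod>i\<in>T. x i)"
      using T U by (simp add: F prod.distrib)
  next
    fix U assume "U \<in> {U. U \<subseteq> free \<and> card U = s}"
    then show "fixd \<union> U - fixd = U"
      "fixd \<union> U \<in> {T. fixd \<subseteq> T \<and> T \<subseteq> fixd \<union> free \<and> card T = r}"
      using ff card_un[of U] r by auto
  qed
  also have "\<dots> = of_real c * (\<Prod>i\<in>fixd. x i) * esym free s ?y"
    by (simp add: esym_def sum_distrib_left)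
  also have "\<dots> \<noteq> 0"
  proof -
    have "x i \<noteq> 0" if "i \<in> V" for i
      using x[of i] a that by (cases "i = a") auto
    then have "(\<Prod>i\<in>fixd. x i) \<noteq> 0" using V fin by auto
    moreover have y: "Im (?y i) > 0" if "i \<in> free - {a}" for i
      using x[of i] that V w[of i] by auto
    have "esym free s ?y \<noteq> 0"
    proof (cases "a \<in> free")
      case True
      have "esym (insert a (free - {a})) s ?y \<noteq> 0"
        using finite_free s True a w[of a] y
        by (intro esym_nonzero_one_real) auto
      then show ?thesis using True by (simp add: insert_absorb)
    next
      case False
      then show ?thesis
        using finite_free s y by (intro esym_nonzero_upper_half_plane) auto
    qed
    ultimately show ?thesis using c by simp
  qed
  finally show ?thesis .
qed

end

section \<open>Frechet classes and consecutive sums\<close>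

lemma eq_bernoulli01_iff:
  assumes q: "q \<in> {0..1}" and g: "set_pmf g \<subseteq> {0, 1}"
  shows "g = bernoulli01 q \<longleftrightarrow> pmf g 1 = q"
proof -
  have 1: "pmf (bernoulli01 q) 1 = q"
    unfolding bernoulli01_def
    using pmf_map_inj'[of "of_bool :: bool \<Rightarrow> nat" "bernoulli_pmf q" True] q
    by (simp add: inj_on_def)
  have sub: "set_pmf (bernoulli01 q) \<subseteq> {0, 1}"
    by (auto simp: bernoulli01_def)
  have det: "h = h'" if "set_pmf h \<subseteq> {0, 1}" "set_pmf h' \<subseteq> {0, 1}" "pmf h 1 = pmf h' 1"
    for h h' :: "nat pmf"
  proof (rule pmf_eqI)
    fix i
    have "pmf h 0 + pmf h 1 = 1" "pmf h' 0 + pmf h' 1 = 1"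
      using sum_pmf_eq_1[OF _ that(1)] sum_pmf_eq_1[OF _ that(2)] by auto
    moreover have "pmf h i = 0 \<and> pmf h' i = 0" if "i \<notin> {0, 1}"
      using that \<open>set_pmf h \<subseteq> {0, 1}\<close> \<open>set_pmf h' \<subseteq> {0, 1}\<close>
      by (meson set_pmf_iff subsetD)
    ultimately show "pmf h i = pmf h' i"
      using that(3) by (cases "i = 0"; cases "i = 1") simp_all
  qed
  show ?thesis using det[OF g sub] 1 by auto
qed

lemma binary_support_cases:
  assumes "set_pmf f \<subseteq> (A \<rightarrow>\<^sub>E {0, 1::nat})" "x \<in> set_pmf f" "j \<in> A"
  shows "x j \<in> {0, 1}"
  using PiE_mem[OF subsetD[OF assms(1,2)] assms(3)] by simp

text \<open>
  A Bernoulli marginal is determined by the probability of the value one.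
\<close>

lemma frechet_class_iff:
  "f \<in> frechet_class A p \<longleftrightarrow> set_pmf f \<subseteq> (A \<rightarrow>\<^sub>E {0, 1}) \<and>
     (\<forall>j\<in>A. p j \<in> {0..1} \<and> measure_pmf.prob f {x. x j = 1} = p j)"
proof -
  have "map_pmf (\<lambda>x. x j) f = bernoulli01 (p j) \<longleftrightarrow> measure_pmf.prob f {x. x j = 1} = p j"
    if "set_pmf f \<subseteq> (A \<rightarrow>\<^sub>E {0, 1})" "j \<in> A" "p j \<in> {0..1}" for j
  proof -
    have "set_pmf (map_pmf (\<lambda>x. x j) f) \<subseteq> {0, 1}"
      unfolding set_map_pmf by (intro image_subsetI binary_support_cases[OF that(1) _ that(2)])
    then have "map_pmf (\<lambda>x. x j) f = bernoulli01 (p j) \<longleftrightarrow> pmf (map_pmf (\<lambda>x. x j) f) 1 = p j"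
      by (rule eq_bernoulli01_iff[OF that(3)])
    then show ?thesis by (simp add: pmf_map vimage_def)
  qed
  then show ?thesis unfolding frechet_class_def by auto
qed

lemma prob_coordinate_eq_sum:
  assumes "finite A" "set_pmf f \<subseteq> (A \<rightarrow>\<^sub>E {0, 1::nat})" "j \<in> A"
  shows "measure_pmf.prob f {x. x j = 1} = (\<Sum>x\<in>A \<rightarrow>\<^sub>E {0, 1}. pmf f x * real (x j))"
proof -
  have fin: "finite (A \<rightarrow>\<^sub>E {0, 1::nat})" using assms(1) by (simp add: finite_PiE)
  have "measure_pmf.prob f {x. x j = 1} = measure_pmf.prob f {x \<in> A \<rightarrow>\<^sub>E {0, 1}. x j = 1}"
    using assms(2) by (intro measure_pmf.finite_measure_eq_AE AE_pmfI)
      (blast, simp_all)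
  also have "\<dots> = (\<Sum>x | x \<in> A \<rightarrow>\<^sub>E {0, 1} \<and> x j = 1. pmf f x)"
    using fin by (simp add: measure_measure_pmf_finite)
  also have "\<dots> = (\<Sum>x | x \<in> A \<rightarrow>\<^sub>E {0, 1} \<and> x j = 1. pmf f x * real (x j))"
    by (intro sum.cong) auto
  also have "\<dots> = (\<Sum>x\<in>A \<rightarrow>\<^sub>E {0, 1}. pmf f x * real (x j))"
  proof (intro sum.mono_neutral_left fin ballI)
    fix x :: "'a \<Rightarrow> nat" assume x: "x \<in> (A \<rightarrow>\<^sub>E {0, 1}) - {x. x \<in> A \<rightarrow>\<^sub>E {0, 1} \<and> x j = 1}"
    then have "x j \<in> {0, 1}" using assms(3) by (blast dest: PiE_mem)
    then show "pmf f x * real (x j) = 0" using x by auto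
  qed blast
  finally show ?thesis .
qed

text \<open>
  When the total of two integers changes by at most one, they cannot both strictly increase or
  both strictly decrease.
\<close>

lemma sigma_countermonotonic_if_consecutive_sums:
  assumes M: "prob_space M" and A: "finite A"
    and sums: "AE \<omega> in M. (\<Sum>j\<in>A. X j \<omega>) \<in> {k, Suc k}"
  shows "sigma_countermonotonic M A X"
  unfolding sigma_countermonotonic_def countermonotonic_def
proof (intro allI impI)
  fix L assume L: "L \<subseteq> A"
  interpret prob_space M by fact
  obtain N where N: "N \<in> null_sets M" "{\<omega> \<in> space M. \<not> (\<Sum>j\<in>A. X j \<omega>) \<in> {k, Suc k}} \<subseteq> N"
    using sums by (auto elim: AE_E simp: null_sets_def)
  have le: "(real a - real a') * (real b - real b') \<le> 0"
    if "a + b \<in> {k, Suc k}" "a' + b' \<in> {k, Suc k}" for a a' b b' :: nat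
  proof (cases "a \<le> a'")
    case True
    then have "b' \<le> b \<or> a = a'" using that by auto
    then show ?thesis using True by (auto simp: mult_le_0_iff)
  next
    case False
    then have "b \<le> b'" using that by auto
    then show ?thesis using False by (auto simp: mult_le_0_iff)
  qed
  show "AE (\<omega>, \<omega>') in M \<Otimes>\<^sub>M M. ((\<Sum>j\<in>L. real (X j \<omega>)) - (\<Sum>j\<in>L. real (X j \<omega>'))) *
      ((\<Sum>j\<in>A - L. real (X j \<omega>)) - (\<Sum>j\<in>A - L. real (X j \<omega>'))) \<le> 0"
  proof (rule AE_I')
    have "N \<times> space M \<in> null_sets (M \<Otimes>\<^sub>M M)" "space M \<times> N \<in> null_sets (M \<Otimes>\<^sub>M M)"
      using N(1) by (auto simp: null_sets_def emeasure_pair_measure_Times)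
    then show "N \<times> space M \<union> space M \<times> N \<in> null_sets (M \<Otimes>\<^sub>M M)"
      by (rule null_sets.Un)
    have split: "(\<Sum>j\<in>L. X j \<omega>) + (\<Sum>j\<in>A - L. X j \<omega>) = (\<Sum>j\<in>A. X j \<omega>)" for \<omega>
      using L A by (metis add.commute sum.subset_diff)
    have "\<omega> \<in> N \<or> \<omega>' \<in> N \<or> ((\<Sum>j\<in>L. real (X j \<omega>)) - (\<Sum>j\<in>L. real (X j \<omega>'))) *
      ((\<Sum>j\<in>A - L. real (X j \<omega>)) - (\<Sum>j\<in>A - L. real (X j \<omega>'))) \<le> 0"
      if "\<omega> \<in> space M" "\<omega>' \<in> space M" for \<omega> \<omega>'
      using le[of "\<Sum>j\<in>L. X j \<omega>" "\<Sum>j\<in>A - L. X j \<omega>" "\<Sum>j\<in>L. X j \<omega>'" "\<Sum>j\<in>A - L. X j \<omega>'"]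
        that N(2) by (auto simp: split)
    then show "{z \<in> space (M \<Otimes>\<^sub>M M). \<not> (case z of (\<omega>, \<omega>') \<Rightarrow>
        ((\<Sum>j\<in>L. real (X j \<omega>)) - (\<Sum>j\<in>L. real (X j \<omega>'))) *
        ((\<Sum>j\<in>A - L. real (X j \<omega>)) - (\<Sum>j\<in>A - L. real (X j \<omega>'))) \<le> 0)}
      \<subseteq> N \<times> space M \<union> space M \<times> N"
      by (auto simp: space_pair_measure)
  qed
qed

text \<open>
  A discrete intermediate value property: terms are added one at a time, and each of them raises
  the sum by at most one, so the sum cannot jump over one.
\<close>

lemma subset_sum_one:
  fixes u :: "'a \<Rightarrow> int"
  assumes "finite A" "\<And>a. a \<in> A \<Longrightarrow> u a \<le> 1" "(\<Sum>a\<in>A. u a) \<ge> 1"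
  shows "\<exists>L\<subseteq>A. (\<Sum>a\<in>L. u a) = 1"
  using assms
proof (induction A)
  case (insert a A)
  show ?case
  proof (cases "(\<Sum>a\<in>A. u a) \<ge> 1")
    case True
    then show ?thesis using insert.IH insert.prems by blast
  next
    case False
    moreover have "(\<Sum>a\<in>insert a A. u a) = u a + (\<Sum>a\<in>A. u a)" "u a \<le> 1"
      using insert by auto
    ultimately have "(\<Sum>a\<in>insert a A. u a) = 1"
      using insert.prems(2) by linarith
    then show ?thesis by blast
  qed
qed simp

text \<open>
  Points of the support are atoms, so a null set of the product avoids them.
\<close>

lemma AE_pair_pmfD:
  assumes "AE z in measure_pmf f \<Otimes>\<^sub>M measure_pmf g. P z" "x \<in> set_pmf f" "y \<in> set_pmf g"
  shows "P (x, y)"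
proof (rule ccontr)
  let ?M = "measure_pmf f \<Otimes>\<^sub>M measure_pmf g"
  assume "\<not> P (x, y)"
  moreover obtain N where N: "{z \<in> space ?M. \<not> P z} \<subseteq> N" "emeasure ?M N = 0" "N \<in> sets ?M"
    using assms(1) by (auto elim: AE_E)
  ultimately have "{x} \<times> {y} \<subseteq> N"
    by (auto simp: space_pair_measure)
  then have "emeasure ?M ({x} \<times> {y}) = 0"
    using N emeasure_mono[of "{x} \<times> {y}" N ?M] by simp
  moreover have "emeasure ?M ({x} \<times> {y}) = ennreal (pmf f x) * ennreal (pmf g y)"
    by (subst measure_pmf.emeasure_pair_measure_Times) (auto simp: emeasure_pmf_single)
  ultimately show False
    using assms(2,3) by (auto simp: set_pmf_iff ennreal_eq_0_iff pmf_nonneg order_antisym)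
qed

text \<open>
  If the totals of two outcomes differed by at least two, some subset of the coordinates would
  account for a difference of exactly one, and its complement would have a difference of the same
  sign.
\<close>

lemma consecutive_sums_if_sigma_countermonotonic:
  assumes A: "finite A" and f: "f \<in> sigma_frechet_class A p"
  obtains k where "\<And>x. x \<in> set_pmf f \<Longrightarrow> (\<Sum>j\<in>A. x j) \<in> {k, Suc k}"
proof -
  have sub: "set_pmf f \<subseteq> (A \<rightarrow>\<^sub>E {0, 1})"
    and scm: "sigma_countermonotonic (measure_pmf f) A (\<lambda>j x. x j)"
    using f by (auto simp: sigma_frechet_class_def frechet_class_iff)
  have le: "(\<Sum>j\<in>A. x j) \<le> Suc (\<Sum>j\<in>A. y j)" if "x \<in> set_pmf f" "y \<in> set_pmf f" for x y
  proof (rule ccontr)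
    assume gt: "\<not> (\<Sum>j\<in>A. x j) \<le> Suc (\<Sum>j\<in>A. y j)"
    let ?u = "\<lambda>j. int (x j) - int (y j)"
    have tot: "(\<Sum>j\<in>A. ?u j) \<ge> 2"
      using gt by (simp add: sum_subtractf flip: of_nat_sum)
    have "?u j \<le> 1" if "j \<in> A" for j
      using binary_support_cases[OF sub \<open>x \<in> set_pmf f\<close> that] by auto
    then obtain L where L: "L \<subseteq> A" "(\<Sum>j\<in>L. ?u j) = 1"
      using subset_sum_one[OF A, of ?u] tot by auto
    have rest: "(\<Sum>j\<in>A - L. ?u j) \<ge> 1"
      using sum.subset_diff[OF L(1) A, of ?u] L(2) tot by simp
    have "AE (\<omega>, \<omega>') in measure_pmf f \<Otimes>\<^sub>M measure_pmf f.
        ((\<Sum>j\<in>L. real (\<omega> j)) - (\<Sum>j\<in>L. real (\<omega>' j))) *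
        ((\<Sum>j\<in>A - L. real (\<omega> j)) - (\<Sum>j\<in>A - L. real (\<omega>' j))) \<le> 0"
      using scm L(1) by (auto simp: sigma_countermonotonic_def countermonotonic_def)
    from AE_pair_pmfD[OF this that]
    have "of_int (\<Sum>j\<in>L. ?u j) * of_int (\<Sum>j\<in>A - L. ?u j) \<le> (0::real)"
      by (simp add: sum_subtractf)
    then show False using rest unfolding L(2) by (simp del: of_int_sum of_int_diff)
  qed
  let ?P = "\<lambda>n. \<exists>x\<in>set_pmf f. (\<Sum>j\<in>A. x j) = n"
  define k where "k = (LEAST n. ?P n)"
  have ex: "\<exists>n. ?P n" using set_pmf_not_empty[of f] by blast
  obtain y where y: "y \<in> set_pmf f" "(\<Sum>j\<in>A. y j) = k"
    using LeastI_ex[OF ex] unfolding k_def by blast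
  have "k \<le> (\<Sum>j\<in>A. x j)" if "x \<in> set_pmf f" for x
    unfolding k_def using that by (intro Least_le[of ?P]) blast
  then show thesis
    using that[of k] le[OF _ y(1)] y(2) by (simp add: le_Suc_eq order_antisym) (metis le_SucE le_antisym)
qed

section \<open>Exchange of mass at an entropy maximizer\<close>

lemma pmf_embed_pmf_finite:
  assumes S: "finite S" "sum g S = 1" and g: "\<And>x. g x \<ge> 0" "\<And>x. x \<notin> S \<Longrightarrow> g x = 0"
  shows "pmf (embed_pmf g) x = g x"
proof (rule pmf_embed_pmf[OF g(1)])
  have "(\<integral>\<^sup>+x. ennreal (g x) \<partial>count_space UNIV) = (\<Sum>x\<in>S. ennreal (g x))"
    using S(1) g by (intro nn_integral_count_space') (auto simp: ennreal_eq_0_iff)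
  then show "(\<integral>\<^sup>+x. ennreal (g x) \<partial>count_space UNIV) = 1"
    using S(2) g(1) by (simp add: sum_ennreal)
qed

text \<open>
  The graph of the convex function \<open>v ln v\<close> lies above its tangent at \<open>u\<close>.  The bound holds
  down to \<open>v = 0\<close>, where the function has no derivative; this case is what forces the support of a
  maximizer of the entropy to be large.
\<close>

lemma x_ln_x_tangent:
  fixes u v :: real
  assumes "u > 0" "v \<ge> 0"
  shows "u * ln u - v * ln v \<le> (ln u + 1) * (u - v)"
proof (cases "v = 0")
  case False
  then have v: "v > 0" using assms by simp
  have "ln (u / v) \<le> u / v - 1"
    using assms v by (intro ln_le_minus_one) simp
  then have "v * (ln u - ln v) \<le> v * (u / v - 1)"
    using assms v by (intro mult_left_mono) (simp_all add: ln_div)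
  then show ?thesis using v by (simp add: algebra_simps)
qed (use assms in \<open>simp add: algebra_simps\<close>)

text \<open>
  Moving mass \<open>e\<close> from each of \<open>x\<close>, \<open>y\<close> to each of \<open>x'\<close>, \<open>y'\<close> preserves the marginals, because
  \<open>x + y = x' + y'\<close>, and preserves \<open>\<Sigma>\<close>-countermonotonicity, because the coordinate sums remain
  consecutive.  The tangent inequality at the new masses bounds the gain of entropy from below by
  \<open>e\<close> times the logarithm of a quotient of products, which is positive if \<open>f x * f y\<close> exceeds
  \<open>f x' * f y'\<close> and \<open>e\<close> is small.  Positivity of \<open>f x'\<close> and \<open>f y'\<close> is thus a consequence.
\<close>

lemma max_entropy_exchange_le:
  assumes A: "finite A"
    and max: "is_arg_max (pmf_entropy A) (\<lambda>f. f \<in> sigma_frechet_class A p) f"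
    and k: "\<And>x. x \<in> set_pmf f \<Longrightarrow> (\<Sum>j\<in>A. x j) \<in> {k, Suc k}"
    and xy: "x \<in> set_pmf f" "y \<in> set_pmf f"
    and x'y': "x' \<in> A \<rightarrow>\<^sub>E {0, 1}" "y' \<in> A \<rightarrow>\<^sub>E {0, 1}"
    and k': "(\<Sum>j\<in>A. x' j) \<in> {k, Suc k}" "(\<Sum>j\<in>A. y' j) \<in> {k, Suc k}"
    and dist: "distinct [x, y, x', y']"
    and eq: "\<And>j. j \<in> A \<Longrightarrow> x j + y j = x' j + y' j"
  shows "pmf f x * pmf f y \<le> pmf f x' * pmf f y'"
proof (rule ccontr)
  assume less: "\<not> ?thesis"
  define S where "S = A \<rightarrow>\<^sub>E {0, 1::nat}"
  have f: "f \<in> sigma_frechet_class A p" and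
    best: "\<And>g. g \<in> sigma_frechet_class A p \<Longrightarrow> pmf_entropy A g \<le> pmf_entropy A f"
    using max by (auto simp: is_arg_max_def not_less)
  have sub: "set_pmf f \<subseteq> S" and
    marg: "\<And>j. j \<in> A \<Longrightarrow> p j \<in> {0..1} \<and> measure_pmf.prob f {x. x j = 1} = p j"
    using f by (auto simp: sigma_frechet_class_def frechet_class_iff S_def)
  have S: "finite S" "x \<in> S" "y \<in> S" "x' \<in> S" "y' \<in> S"
    using sub xy x'y' finite_PiE[OF A, of "\<lambda>_. {0, 1::nat}"] unfolding S_def by blast+
  define a b c d where "a = pmf f x" and "b = pmf f y" and "c = pmf f x'" and "d = pmf f y'"
  have pos: "a > 0" "b > 0" "c \<ge> 0" "d \<ge> 0"
    using xy[THEN pmf_positive] by (simp_all add: a_def b_def c_def d_def)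
  have gap: "a * b - c * d > 0" using less by (simp add: a_def b_def c_def d_def)
  define s where "s = a + b + c + d"
  have s: "s > 0" "a \<le> s" "b \<le> s" using pos by (auto simp: s_def)
  \<comment> \<open>Small enough that at most half of the gap \<open>a * b - c * d\<close> is used up, hence also \<open>e < a, b\<close>.\<close>
  define e where "e = (a * b - c * d) / (2 * s)"
  have e: "e > 0" using gap s by (simp add: e_def)
  have es: "e * s = (a * b - c * d) / 2"
    using s by (simp add: e_def)
  have "e * s < a * b"
    using es gap mult_nonneg_nonneg[OF pos(3,4)] by simp
  moreover have "e * b \<le> e * s" "e * a \<le> e * s"
    using s e by simp_all
  ultimately have "e * b < a * b" "e * a < b * a"
    using mult.commute[of a b] by linarith+
  then have ea: "e < a" "e < b" using pos by simp_all
  have prod: "(c + e) * (d + e) < (a - e) * (b - e)"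
  proof -
    have "(a - e) * (b - e) - (c + e) * (d + e) = (a * b - c * d) - e * s"
      by (simp add: s_def algebra_simps)
    also have "\<dots> = (a * b - c * d) / 2"
      unfolding es by (simp add: field_simps)
    also have "\<dots> > 0" using gap by simp
    finally show ?thesis by (simp only: diff_gt_0_iff_gt)
  qed
  define \<delta> :: "('a \<Rightarrow> nat) \<Rightarrow> real" where
    "\<delta> z = of_bool (z = x') + of_bool (z = y') - of_bool (z = x) - of_bool (z = y)" for z
  define g where "g z = pmf f z + e * \<delta> z" for z
  have sum_\<delta>: "(\<Sum>z\<in>S. \<delta> z * h z) = h x' + h y' - h x - h y" for h
  proof -
    have "(\<Sum>z\<in>S. of_bool (z = v) * h z) = h v" if "v \<in> S" for v
      using S(1) that by (simp add: sum.delta of_bool_def if_distrib[of "\<lambda>c. c * _"] cong: if_cong)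
    then show ?thesis
      using S by (simp add: \<delta>_def algebra_simps sum.distrib sum_subtractf)
  qed
  have \<delta>: "\<delta> x = -1" "\<delta> y = -1" "\<delta> x' = 1" "\<delta> y' = 1"
    using dist by (auto simp: \<delta>_def)
  have \<delta>0: "\<delta> z = 0" if "z \<notin> {x, y, x', y'}" for z
    using that by (auto simp: \<delta>_def)
  have g_vals: "g x = a - e" "g y = b - e" "g x' = c + e" "g y' = d + e"
    by (simp_all add: g_def \<delta> a_def b_def c_def d_def)
  have g_pos: "g z > 0 \<or> (g z = 0 \<and> pmf f z = 0)" for z
  proof (cases "z \<in> {x, y, x', y'}")
    case True
    then show ?thesis using g_vals ea pos e by auto
  next
    case False
    then show ?thesis using \<delta>0 by (simp add: g_def less_le)
  qed
  have g_sum: "(\<Sum>z\<in>S. g z * h z) = (\<Sum>z\<in>S. pmf f z * h z) + e * (h x' + h y' - h x - h y)" for h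
  proof -
    have "g z * h z = pmf f z * h z + e * (\<delta> z * h z)" for z
      by (simp add: g_def distrib_right)
    then show ?thesis
      by (simp add: sum.distrib sum_\<delta> flip: sum_distrib_left)
  qed
  define G where "G = embed_pmf g"
  have pmf_G: "pmf G z = g z" for z
    unfolding G_def
  proof (rule pmf_embed_pmf_finite[OF S(1)])
    show "sum g S = 1"
      using g_sum[of "\<lambda>_. 1"] sum_pmf_eq_1[OF S(1) sub] by simp
    show "g z \<ge> 0" for z using g_pos[of z] by auto
    show "g z = 0" if "z \<notin> S" for z
    proof -
      have "z \<notin> {x, y, x', y'}" "z \<notin> set_pmf f" using that S sub by auto
      then show ?thesis using \<delta>0 by (simp add: g_def pmf_eq_0_set_pmf)
    qed
  qed
  have supp_G: "set_pmf G \<subseteq> set_pmf f \<union> {x', y'}"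
  proof
    fix z assume "z \<in> set_pmf G"
    then have "pmf f z + e * \<delta> z \<noteq> 0" by (simp add: set_pmf_iff pmf_G g_def)
    then have "z \<in> {x, y, x', y'} \<or> z \<in> set_pmf f" using \<delta>0[of z] by (auto simp: set_pmf_iff)
    then show "z \<in> set_pmf f \<union> {x', y'}" using xy by blast
  qed
  then have sub_G: "set_pmf G \<subseteq> S" using sub S by auto
  have "G \<in> sigma_frechet_class A p"
  proof -
    have "measure_pmf.prob G {x. x j = 1} = p j" if j: "j \<in> A" for j
    proof -
      have "real (x' j) + real (y' j) - real (x j) - real (y j) = 0"
        using eq[OF j] by linarith
      then have "(\<Sum>z\<in>S. g z * real (z j)) = (\<Sum>z\<in>S. pmf f z * real (z j))"
        using g_sum[of "\<lambda>z. real (z j)"] by simp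
      then show ?thesis
        using prob_coordinate_eq_sum[OF A _ j, of G] prob_coordinate_eq_sum[OF A _ j, of f]
          marg[OF j] sub sub_G by (simp add: S_def pmf_G)
    qed
    moreover have "(\<Sum>j\<in>A. z j) \<in> {k, Suc k}" if "z \<in> set_pmf G" for z
      using that supp_G k k' by auto
    then have "sigma_countermonotonic (measure_pmf G) A (\<lambda>j x. x j)"
      by (intro sigma_countermonotonic_if_consecutive_sums[OF measure_pmf.prob_space_axioms A] AE_pmfI)
    ultimately show ?thesis
      using marg sub_G by (auto simp: sigma_frechet_class_def frechet_class_iff S_def)
  qed
  then have "pmf_entropy A G \<le> pmf_entropy A f" by (rule best)
  moreover have "pmf_entropy A f < pmf_entropy A G"
  proof -
    \<comment> \<open>The entropy carries a minus sign, so the sum of \<open>g ln g\<close> has to be the smaller one.\<close>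
    have "(\<Sum>z\<in>S. g z * ln (g z)) - (\<Sum>z\<in>S. pmf f z * ln (pmf f z))
        = (\<Sum>z\<in>S. g z * ln (g z) - pmf f z * ln (pmf f z))"
      by (simp add: sum_subtractf)
    also have "\<dots> \<le> (\<Sum>z\<in>S. (ln (g z) + 1) * (g z - pmf f z))"
    proof (rule sum_mono)
      fix z
      show "g z * ln (g z) - pmf f z * ln (pmf f z) \<le> (ln (g z) + 1) * (g z - pmf f z)"
        using g_pos[of z] x_ln_x_tangent[of "g z" "pmf f z"] by auto
    qed
    also have "\<dots> = e * (\<Sum>z\<in>S. \<delta> z * (ln (g z) + 1))"
      by (simp add: g_def sum_distrib_left mult_ac)
    also have "\<dots> = e * (ln ((c + e) * (d + e)) - ln ((a - e) * (b - e)))"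
      using ea e pos by (simp add: sum_\<delta> g_vals ln_mult)
    also have "\<dots> < 0"
      using prod e ea pos by (intro mult_pos_neg) (simp_all add: add_nonneg_pos)
    finally show ?thesis unfolding pmf_entropy_def S_def[symmetric] pmf_G by simp
  qed
  ultimately show False by simp
qed

section \<open>The generating function of the maximum entropy law\<close>

text \<open>
  Binary vectors with coordinate sum \<open>k\<close> or \<open>k + 1\<close> correspond to the subsets of size \<open>k + 1\<close> of
  the index set enlarged by the slack element \<open>None\<close>, which is present exactly when the sum is
  \<open>k\<close>.  This puts the two layers into a single one, where the exchange property applies.
\<close>

definition slack_vector :: "'i set \<Rightarrow> 'i option set \<Rightarrow> 'i \<Rightarrow> nat" where
  "slack_vector A T = (\<lambda>j\<in>A. of_bool (Some j \<in> T))"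

definition slack_set :: "'i set \<Rightarrow> nat \<Rightarrow> ('i \<Rightarrow> nat) \<Rightarrow> 'i option set" where
  "slack_set A k x = Some ` {j \<in> A. x j = 1} \<union> (if (\<Sum>j\<in>A. x j) = k then {None} else {})"

lemma slack_vector_range: "slack_vector A T \<in> A \<rightarrow>\<^sub>E {0, 1}"
  by (auto simp: slack_vector_def)

lemma slack_vector_sum:
  assumes A: "finite A" and T: "T \<subseteq> insert None (Some ` A)"
  shows "(\<Sum>j\<in>A. slack_vector A T j) + of_bool (None \<in> T) = card T"
proof -
  have "(\<Sum>j\<in>A. slack_vector A T j) = card {j \<in> A. Some j \<in> T}"
    using A by (simp add: slack_vector_def of_bool_def sum.If_cases Int_def)
  also have "\<dots> = card (Some ` {j \<in> A. Some j \<in> T})"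
    by (simp add: card_image)
  also have "Some ` {j \<in> A. Some j \<in> T} = T - {None}"
    using T by auto
  finally have "(\<Sum>j\<in>A. slack_vector A T j) = card (T - {None})" .
  moreover have "finite T" using A T finite_subset by auto
  ultimately show ?thesis
    using card_Suc_Diff1[of T None] by (cases "None \<in> T") auto
qed

lemma slack_vector_sum_range:
  assumes "finite A" "T \<subseteq> insert None (Some ` A)" "card T = Suc k"
  shows "(\<Sum>j\<in>A. slack_vector A T j) \<in> {k, Suc k}"
  using slack_vector_sum[OF assms(1,2)] assms(3) by (cases "None \<in> T") simp_all

lemma slack_set_slack_vector:
  assumes "finite A" "T \<subseteq> insert None (Some ` A)" "card T = Suc k"
  shows "slack_set A k (slack_vector A T) = T"
proof -
  have "(\<Sum>j\<in>A. slack_vector A T j) = k \<longleftrightarrow> None \<in> T"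
    using slack_vector_sum[OF assms(1,2)] assms(3) by (cases "None \<in> T") simp_all
  moreover have "Some ` {j \<in> A. slack_vector A T j = 1} = T - {None}"
    using assms(2) by (auto simp: slack_vector_def)
  ultimately show ?thesis by (auto simp: slack_set_def)
qed

lemma slack_vector_slack_set:
  assumes "x \<in> A \<rightarrow>\<^sub>E {0, 1}"
  shows "slack_vector A (slack_set A k x) = x"
proof
  fix j
  have "x j \<in> {0, 1}" if "j \<in> A"
    using PiE_mem[OF assms that] .
  moreover have "x j = undefined" if "j \<notin> A"
    using PiE_arb[OF assms that] .
  ultimately show "slack_vector A (slack_set A k x) j = x j"
    by (cases "j \<in> A") (auto simp: slack_vector_def slack_set_def)
qed

lemma slack_set_range:
  assumes A: "finite A" and x: "x \<in> A \<rightarrow>\<^sub>E {0, 1}" and k: "(\<Sum>j\<in>A. x j) \<in> {k, Suc k}"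
  shows "slack_set A k x \<subseteq> insert None (Some ` A)" "card (slack_set A k x) = Suc k"
proof -
  show sub: "slack_set A k x \<subseteq> insert None (Some ` A)"
    by (auto simp: slack_set_def)
  have "None \<in> slack_set A k x \<longleftrightarrow> (\<Sum>j\<in>A. x j) = k"
    by (auto simp: slack_set_def)
  then have "(\<Sum>j\<in>A. x j) + of_bool ((\<Sum>j\<in>A. x j) = k) = card (slack_set A k x)"
    using slack_vector_sum[OF A sub] by (simp only: slack_vector_slack_set[OF x])
  then show "card (slack_set A k x) = Suc k"
    using k by (cases "(\<Sum>j\<in>A. x j) = k") simp_all
qed

lemma slack_vector_swap:
  assumes "i \<in> U - T" "j \<in> T - U" "a \<in> A"
  shows "slack_vector A T a + slack_vector A U a =
    slack_vector A (swap j i T) a + slack_vector A (swap i j U) a"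
  using assms by (cases "Some a = i"; cases "Some a = j") (auto simp: slack_vector_def swap_def)

lemma prod_slack_set:
  fixes z :: "'i \<Rightarrow> complex"
  assumes A: "finite A" and x: "x \<in> A \<rightarrow>\<^sub>E {0, 1}"
  shows "(\<Prod>t\<in>slack_set A k x. case_option 1 z t) = (\<Prod>j\<in>A. z j ^ x j)"
proof -
  have "(\<Prod>t\<in>slack_set A k x. case_option 1 z t) = (\<Prod>t\<in>Some ` {j \<in> A. x j = 1}. case_option 1 z t)"
    using A by (intro prod.mono_neutral_right) (auto simp: slack_set_def)
  also have "\<dots> = (\<Prod>j | j \<in> A \<and> x j = 1. z j)"
    by (subst prod.reindex) auto
  also have "\<dots> = (\<Prod>j | j \<in> A \<and> x j = 1. z j ^ x j)"
    by (intro prod.cong) auto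
  also have "\<dots> = (\<Prod>j\<in>A. z j ^ x j)"
  proof (intro prod.mono_neutral_left A ballI)
    fix j assume j: "j \<in> A - {j. j \<in> A \<and> x j = 1}"
    then have "x j \<in> {0, 1}" using PiE_mem[OF x] by blast
    then show "z j ^ x j = 1" using j by auto
  qed auto
  finally show ?thesis .
qed

text \<open>
  The generating function of a maximizer is the generating polynomial of its weight on subsets
  of the enlarged index set, evaluated at the real number one in the slack variable.  The exchange
  inequality holds for every pair of sets of positive weight.  The new sets then have positive weight
  too, and the inequality for the reverse exchange turns it into an equality.
\<close>

lemma max_entropy_pgf_nonzero:
  fixes z :: "'i \<Rightarrow> complex"
  assumes A: "finite A"
    and max: "is_arg_max (pmf_entropy A) (\<lambda>f. f \<in> sigma_frechet_class A p) f"
    and z: "\<And>j. j \<in> A \<Longrightarrow> Im (z j) > 0"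
  shows "(\<Sum>x\<in>A \<rightarrow>\<^sub>E {0, 1}. of_real (pmf f x) * (\<Prod>j\<in>A. z j ^ x j)) \<noteq> 0"
proof -
  have f: "f \<in> sigma_frechet_class A p" using max by (simp add: is_arg_max_def)
  then have sub: "set_pmf f \<subseteq> A \<rightarrow>\<^sub>E {0, 1}"
    by (auto simp: sigma_frechet_class_def frechet_class_def)
  obtain k where k: "\<And>x. x \<in> set_pmf f \<Longrightarrow> (\<Sum>j\<in>A. x j) \<in> {k, Suc k}"
    using consecutive_sums_if_sigma_countermonotonic[OF A f] by metis
  define V where "V = insert None (Some ` A)"
  define F where "F T = (if T \<subseteq> V \<and> card T = Suc k then pmf f (slack_vector A T) else 0)" for T
  have V: "finite V" using A by (simp add: V_def)
  have F_supp: "T \<subseteq> V \<and> card T = Suc k \<and> slack_vector A T \<in> set_pmf f" if "F T > 0" for T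
    using that by (auto simp: F_def set_pmf_iff split: if_splits)
  have le: "F T * F U \<le> F (swap j i T) * F (swap i j U)"
    if T: "F T > 0" and U: "F U > 0" and i: "i \<in> U - T" and j: "j \<in> T - U" for T U i j
  \<comment> \<open>The exchange may only interchange the two sets, and then no mass is moved.\<close>
  proof (cases "swap j i T = U")
    case True
    then have "swap i j U = T" using swap_id[of j T i] i j by auto
    then show ?thesis using True by simp
  next
    case False
    have ij: "i \<noteq> j" using i j by auto
    have card_swap: "swap j i W \<subseteq> V \<and> card (swap j i W) = Suc k"
      if "W \<subseteq> V" "card W = Suc k" "i \<in> V" "i \<notin> W" "j \<in> W" for W i j
    proof -
      have "finite W" using that V finite_subset by auto
      then show ?thesis using that by (auto simp: swap_def)
    qed
    have T': "T \<subseteq> V" "card T = Suc k" "U \<subseteq> V" "card U = Suc k"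
      and s: "slack_vector A T \<in> set_pmf f" "slack_vector A U \<in> set_pmf f"
      using F_supp[OF T] F_supp[OF U] by auto
    have sw: "swap j i T \<subseteq> V" "card (swap j i T) = Suc k" "swap i j U \<subseteq> V" "card (swap i j U) = Suc k"
      using card_swap[of T i j] card_swap[of U j i] T' i j by auto
    have inj: "W = W'" if "W \<subseteq> V" "card W = Suc k" "W' \<subseteq> V" "card W' = Suc k"
      "slack_vector A W = slack_vector A W'" for W W'
      using slack_set_slack_vector[OF A] that unfolding V_def by metis
    have "T \<noteq> U" "T \<noteq> swap j i T" "T \<noteq> swap i j U" "U \<noteq> swap j i T" "U \<noteq> swap i j U"
      "swap j i T \<noteq> swap i j U"
      using False i j ij swap_id[of i U j] by (auto simp: swap_def)
    then have dist: "distinct [slack_vector A T, slack_vector A U,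
        slack_vector A (swap j i T), slack_vector A (swap i j U)]"
      using inj[OF T'] inj[OF T'(1,2) sw(1,2)] inj[OF T'(1,2) sw(3,4)] inj[OF T'(3,4) sw(1,2)]
        inj[OF T'(3,4) sw(3,4)] inj[OF sw]
      by (simp only: distinct.simps list.set insert_iff empty_iff) blast
    have "pmf f (slack_vector A T) * pmf f (slack_vector A U)
        \<le> pmf f (slack_vector A (swap j i T)) * pmf f (slack_vector A (swap i j U))"
    proof (rule max_entropy_exchange_le[OF A max k s slack_vector_range slack_vector_range _ _ dist])
      show "(\<Sum>a\<in>A. slack_vector A (swap j i T) a) \<in> {k, Suc k}"
        "(\<Sum>a\<in>A. slack_vector A (swap i j U) a) \<in> {k, Suc k}"
        using slack_vector_sum_range[OF A] sw unfolding V_def by blast+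
    qed (assumption, rule slack_vector_swap[OF i j])
    then show ?thesis using T' sw by (simp add: F_def)
  qed
  interpret exchange F V "Suc k"
  proof
    show "finite V" by (rule V)
    show "F T \<ge> 0" for T by (simp add: F_def)
    show "T \<subseteq> V \<and> card T = Suc k" if "F T > 0" for T using F_supp[OF that] by simp
    fix T U i j assume T: "F T > 0" and U: "F U > 0" and i: "i \<in> U - T" and j: "j \<in> T - U"
    let ?T = "swap j i T" and ?U = "swap i j U"
    have "F ?T * F ?U > 0"
      using le[OF T U i j] mult_pos_pos[OF T U] by linarith
    moreover have "F ?T \<ge> 0" "F ?U \<ge> 0" by (simp_all add: F_def)
    ultimately have "F ?T > 0" "F ?U > 0"
      by (auto simp: zero_less_mult_iff)
    moreover have "i \<in> ?T - ?U" "j \<in> ?U - ?T" using i j by (auto simp: swap_def)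
    moreover have "swap i j ?T = T" "swap j i ?U = U"
      using i j swap_id[of j T i] swap_id[of i U j] by auto
    ultimately have "F ?T * F ?U \<le> F T * F U" using le[of ?T ?U j i] by auto
    then show "F ?T * F ?U = F T * F U" using le[OF T U i j] by linarith
  qed
  obtain x0 where x0: "x0 \<in> set_pmf f" using set_pmf_not_empty[of f] by blast
  have mem: "x \<in> A \<rightarrow>\<^sub>E {0, 1}" if "x \<in> set_pmf f" for x using sub that by blast
  have F_slack: "F (slack_set A k x) = pmf f x" if "x \<in> set_pmf f" for x
    using slack_set_range[OF A mem[OF that] k[OF that]] slack_vector_slack_set[OF mem[OF that], of k]
    by (simp add: F_def V_def)
  have "(\<Sum>T\<in>Pow V. of_real (F T) * (\<Prod>t\<in>T. case_option 1 z t)) \<noteq> 0"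
  proof (rule generating_polynomial_nonzero[of "slack_set A k x0" None])
    show "F (slack_set A k x0) > 0"
      using F_slack[OF x0] pmf_positive[OF x0] by simp
  qed (use z in \<open>auto simp: V_def\<close>)
  also have "(\<Sum>T\<in>Pow V. of_real (F T) * (\<Prod>t\<in>T. case_option 1 z t)) =
      (\<Sum>T | T \<in> Pow V \<and> F T > 0. of_real (F T) * (\<Prod>t\<in>T. case_option 1 z t))"
    using V nonneg by (intro sum.mono_neutral_right) (auto simp: less_le)
  also have "\<dots> = (\<Sum>x\<in>set_pmf f. of_real (pmf f x) * (\<Prod>j\<in>A. z j ^ x j))"
  proof (rule sum.reindex_bij_witness[of _ "slack_set A k" "slack_vector A"])
    fix T assume "T \<in> {T. T \<in> Pow V \<and> F T > 0}"
    then have T: "T \<subseteq> V" "card T = Suc k" "slack_vector A T \<in> set_pmf f"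
      using F_supp by auto
    show "slack_vector A T \<in> set_pmf f" by (rule T)
    show eq: "slack_set A k (slack_vector A T) = T"
      using slack_set_slack_vector[OF A] T by (simp add: V_def)
    show "of_real (pmf f (slack_vector A T)) * (\<Prod>j\<in>A. z j ^ slack_vector A T j) =
        of_real (F T) * (\<Prod>t\<in>T. case_option 1 z t)"
      using prod_slack_set[OF A slack_vector_range[of A T], where k = k and z = z] T by (simp add: eq F_def)
  next
    fix x assume x: "x \<in> set_pmf f"
    show "slack_vector A (slack_set A k x) = x" by (rule slack_vector_slack_set[OF mem[OF x]])
    show "slack_set A k x \<in> {T. T \<in> Pow V \<and> F T > 0}"
      using slack_set_range[OF A mem[OF x] k[OF x]] F_slack[OF x] pmf_positive[OF x]
      by (simp add: V_def)
  qed
  also have "\<dots> = (\<Sum>x\<in>A \<rightarrow>\<^sub>E {0, 1}. of_real (pmf f x) * (\<Prod>j\<in>A. z j ^ x j))"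
    using sub finite_PiE[OF A, of "\<lambda>_. {0, 1::nat}"]
    by (intro sum.mono_neutral_left) (simp_all add: set_pmf_iff)
  finally show ?thesis .
qed

section \<open>The lower Frechet bound with equal means\<close>

text \<open>
  The lower bound vanishes at the zero vector, since the marginals sum to one, so almost surely
  some coordinate is one.  The coordinate sum is thus at least one and has mean one.
\<close>

lemma lower_frechet_bound_one_hot:
  assumes A: "finite A" "A \<noteq> {}"
    and f: "is_lower_frechet_bound A (\<lambda>_. 1 / real (card A)) f"
    and x: "x \<in> set_pmf f"
  shows "(\<Sum>j\<in>A. x j) = 1"
proof -
  let ?n = "real (card A)" and ?S = "A \<rightarrow>\<^sub>E {0, 1::nat}"
  have n: "?n > 0" using A by (simp add: card_gt_0_iff)
  have S: "finite ?S" using A by (intro finite_PiE) auto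
  have sub: "set_pmf f \<subseteq> ?S"
    and q: "1 / ?n \<in> {0..1}"
    and marg: "\<And>j. j \<in> A \<Longrightarrow> measure_pmf.prob f {x. x j = 1} = 1 / ?n"
    using f A by (auto simp: is_lower_frechet_bound_def frechet_class_iff)
  have "pmf (bernoulli01 (1 / ?n)) 0 = 1 - 1 / ?n"
    unfolding bernoulli01_def
    using pmf_map_inj'[of "of_bool :: bool \<Rightarrow> nat" "bernoulli_pmf (1 / ?n)" False] q
    by (simp add: inj_on_def)
  then have b0: "measure_pmf.prob (bernoulli01 (1 / ?n)) {..0} = 1 - 1 / ?n"
    by (simp add: atMost_0 measure_pmf_single)
  define v :: "'a \<Rightarrow> nat" where "v = (\<lambda>j\<in>A. 0)"
  have v: "v \<in> ?S" by (auto simp: v_def)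
  have "lower_frechet_fun A (\<lambda>_. 1 / ?n) v
      = max ((\<Sum>j\<in>A. measure_pmf.prob (bernoulli01 (1 / ?n)) {..0}) - ?n + 1) 0"
    unfolding lower_frechet_fun_def v_def by simp
  also have "\<dots> = 0" unfolding b0 using n by (simp add: field_simps)
  finally have "joint_cdf A f v = 0"
    using f v by (auto simp: is_lower_frechet_bound_def)
  then have disj: "set_pmf f \<inter> {x. \<forall>j\<in>A. x j \<le> v j} = {}"
    by (simp add: joint_cdf_def measure_pmf_zero_iff)
  have ge: "(\<Sum>j\<in>A. y j) \<ge> 1" if "y \<in> set_pmf f" for y
  proof (rule ccontr)
    assume "\<not> ?thesis"
    then have "(\<Sum>j\<in>A. y j) = 0" by simp
    then have "y \<in> {x. \<forall>j\<in>A. x j \<le> v j}" using A by (simp add: v_def)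
    then show False using that disj by blast
  qed
  have "(\<Sum>y\<in>?S. pmf f y * real (\<Sum>j\<in>A. y j)) = (\<Sum>j\<in>A. \<Sum>y\<in>?S. pmf f y * real (y j))"
    by (simp add: sum_distrib_left) (rule sum.swap)
  also have "\<dots> = (\<Sum>j\<in>A. 1 / ?n)"
    using prob_coordinate_eq_sum[OF A(1) sub] marg by (intro sum.cong) auto
  also have "\<dots> = (\<Sum>y\<in>?S. pmf f y)"
    using n sum_pmf_eq_1[OF S sub] by simp
  finally have "(\<Sum>y\<in>?S. pmf f y * (real (\<Sum>j\<in>A. y j) - 1)) = 0"
    by (simp only: right_diff_distrib sum_subtractf mult_1_right diff_self)
  moreover have "pmf f y * (real (\<Sum>j\<in>A. y j) - 1) \<ge> 0" for y
    using ge[of y] by (cases "y \<in> set_pmf f") (simp_all add: set_pmf_iff del: of_nat_sum)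
  ultimately have "pmf f x * (real (\<Sum>j\<in>A. x j) - 1) = 0"
    using sum_nonneg_eq_0_iff[OF S, of "\<lambda>y. pmf f y * (real (\<Sum>j\<in>A. y j) - 1)"] sub x by blast
  then show ?thesis
    using x by (simp add: set_pmf_iff del: of_nat_sum)
qed

lemma prod_power_one_hot:
  fixes z :: "'i \<Rightarrow> complex"
  assumes A: "finite A" and x: "(\<Sum>j\<in>A. x j) = (1::nat)"
  shows "(\<Prod>j\<in>A. z j ^ x j) = (\<Sum>j\<in>A. of_nat (x j) * z j)"
proof -
  obtain a where a: "a \<in> A" "x a = 1" "\<And>b. b \<in> A \<Longrightarrow> b \<noteq> a \<Longrightarrow> x b = 0"
    using x sum_eq_1_iff[OF A, of x] by auto
  have "(\<Prod>j\<in>A. z j ^ x j) = z a * (\<Prod>j\<in>A - {a}. z j ^ x j)"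
    using a by (simp add: prod.remove[OF A])
  moreover have "(\<Sum>j\<in>A. of_nat (x j) * z j) = z a + (\<Sum>j\<in>A - {a}. of_nat (x j) * z j)"
    using a by (simp add: sum.remove[OF A])
  moreover have "(\<Prod>j\<in>A - {a}. z j ^ x j) = 1" "(\<Sum>j\<in>A - {a}. of_nat (x j) * z j) = 0"
    using a by (auto intro!: prod.neutral sum.neutral)
  ultimately show ?thesis by simp
qed

text \<open>
  Only one coordinate equals one, so the monomial is the value of \<open>z\<close> there, and that coordinate
  is uniformly distributed.
\<close>

lemma lower_frechet_bound_pgf:
  fixes z :: "'i \<Rightarrow> complex"
  assumes A: "finite A" "A \<noteq> {}"
    and f: "is_lower_frechet_bound A (\<lambda>_. 1 / real (card A)) f"
  shows "measure_pmf.expectation f (\<lambda>x. \<Prod>j\<in>A. z j ^ x j) = (\<Sum>j\<in>A. z j) / of_nat (card A)"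
proof -
  let ?S = "A \<rightarrow>\<^sub>E {0, 1::nat}"
  have S: "finite ?S" using A by (intro finite_PiE) auto
  have sub: "set_pmf f \<subseteq> ?S"
    and marg: "\<And>j. j \<in> A \<Longrightarrow> measure_pmf.prob f {x. x j = 1} = 1 / real (card A)"
    using f by (auto simp: is_lower_frechet_bound_def frechet_class_iff)
  have "measure_pmf.expectation f (\<lambda>x. \<Prod>j\<in>A. z j ^ x j)
      = (\<Sum>x\<in>?S. pmf f x *\<^sub>R (\<Prod>j\<in>A. z j ^ x j))"
    using sub by (intro integral_measure_pmf[OF S]) blast
  also have "\<dots> = (\<Sum>x\<in>?S. \<Sum>j\<in>A. of_real (pmf f x * real (x j)) * z j)"
  proof (rule sum.cong[OF refl])
    fix x
    show "pmf f x *\<^sub>R (\<Prod>j\<in>A. z j ^ x j) = (\<Sum>j\<in>A. of_real (pmf f x * real (x j)) * z j)"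
    proof (cases "x \<in> set_pmf f")
      case True
      from lower_frechet_bound_one_hot[OF A f this] show ?thesis
        by (simp add: prod_power_one_hot[OF A(1)] scaleR_conv_of_real sum_distrib_left mult.assoc)
    qed (simp add: set_pmf_iff)
  qed
  also have "\<dots> = (\<Sum>j\<in>A. of_real (\<Sum>x\<in>?S. pmf f x * real (x j)) * z j)"
    unfolding of_real_sum sum_distrib_right by (rule sum.swap)
  also have "\<dots> = (\<Sum>j\<in>A. z j / of_nat (card A))"
    using prob_coordinate_eq_sum[OF A(1) sub] marg by (intro sum.cong) auto
  finally show ?thesis by (simp add: sum_divide_distrib)
qed

section \<open>Laws of random vectors and independent selection\<close>

lemma random_vector_apply: "j \<in> A \<Longrightarrow> random_vector A X \<omega> j = X j \<omega>"
  by (simp add: random_vector_def)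

lemma sum_random_vector: "(\<Sum>j\<in>A. random_vector A X \<omega> j) = (\<Sum>j\<in>A. X j \<omega>)"
  by (intro sum.cong) (simp_all add: random_vector_apply)

text \<open>
  The vectors of natural numbers that are undefined outside a finite set form a countable set, on which the product
  sigma-algebra is discrete.
\<close>

lemma random_vector_measurable:
  assumes A: "finite A" and X: "\<And>j. j \<in> A \<Longrightarrow> X j \<in> M \<rightarrow>\<^sub>M count_space UNIV"
  shows "random_vector A X \<in> M \<rightarrow>\<^sub>M count_space UNIV"
proof -
  have "(\<lambda>\<omega>. \<lambda>j\<in>A. X j \<omega>) \<in> M \<rightarrow>\<^sub>M PiM A (\<lambda>_. count_space (UNIV :: nat set))"
    using X by (rule measurable_restrict)
  also have "PiM A (\<lambda>_. count_space (UNIV :: nat set)) = count_space (PiE A (\<lambda>_. UNIV))"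
    using A by (rule count_space_PiM_finite) simp
  finally have m: "(\<lambda>\<omega>. \<lambda>j\<in>A. X j \<omega>) \<in> M \<rightarrow>\<^sub>M count_space (PiE A (\<lambda>_. UNIV))" .
  have "(\<lambda>\<omega>. id (\<lambda>j\<in>A. X j \<omega>)) \<in> M \<rightarrow>\<^sub>M count_space UNIV"
    using m by (rule measurable_compose) simp
  moreover have "random_vector A X = (\<lambda>\<omega>. id (\<lambda>j\<in>A. X j \<omega>))"
    by (simp add: random_vector_def fun_eq_iff)
  ultimately show ?thesis by simp
qed

lemma has_pmf_component_measurable:
  assumes "has_pmf M A X f" "j \<in> A"
  shows "X j \<in> M \<rightarrow>\<^sub>M count_space UNIV"
proof -
  have V: "random_vector A X \<in> M \<rightarrow>\<^sub>M count_space UNIV"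
    using assms(1) by (simp add: has_pmf_def)
  have "(\<lambda>\<omega>. random_vector A X \<omega> j) \<in> M \<rightarrow>\<^sub>M count_space UNIV"
    by (rule measurable_compose[OF V]) simp
  then show ?thesis using assms(2) by (simp add: random_vector_def)
qed

lemma has_pmf_prob:
  assumes "has_pmf M A X f"
  shows "measure M {\<omega> \<in> space M. random_vector A X \<omega> \<in> B} = measure_pmf.prob f B"
proof -
  have "measure (distr M (count_space UNIV) (random_vector A X)) B =
      measure M (random_vector A X -` B \<inter> space M)"
    using assms by (intro measure_distr) (auto simp: has_pmf_def)
  then show ?thesis
    using assms by (simp add: has_pmf_def vimage_def Int_def conj_commute)
qed

lemma has_pmf_AE:
  assumes "has_pmf M A X f" "\<And>x. x \<in> set_pmf f \<Longrightarrow> P x"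
  shows "AE \<omega> in M. P (random_vector A X \<omega>)"
proof -
  have "AE x in distr M (count_space UNIV) (random_vector A X). P x"
    using AE_pmfI[of f P, OF assms(2)] assms(1) by (simp only: has_pmf_def)
  then show ?thesis
    using assms(1) by (subst (asm) AE_distr_iff) (auto simp: has_pmf_def)
qed

lemma has_pmf_expectation:
  fixes G :: "('i \<Rightarrow> nat) \<Rightarrow> complex"
  assumes "has_pmf M A X f"
  shows "(\<integral>\<omega>. G (random_vector A X \<omega>) \<partial>M) = measure_pmf.expectation f G"
proof -
  have "(\<integral>x. G x \<partial>distr M (count_space UNIV) (random_vector A X)) =
      (\<integral>\<omega>. G (random_vector A X \<omega>) \<partial>M)"
    using assms by (intro integral_distr) (auto simp: has_pmf_def)
  then show ?thesis using assms by (simp add: has_pmf_def)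
qed

lemma has_pmf_integrable:
  fixes G :: "('i \<Rightarrow> nat) \<Rightarrow> complex"
  assumes f: "has_pmf M A X f" and fin: "finite (set_pmf f)"
  shows "integrable M (\<lambda>\<omega>. G (random_vector A X \<omega>))"
proof -
  have "integrable (distr M (count_space UNIV) (random_vector A X)) G"
    using f integrable_measure_pmf_finite[OF fin] by (simp add: has_pmf_def)
  then show ?thesis
    using f by (subst (asm) integrable_distr_eq) (auto simp: has_pmf_def)
qed

text \<open>
  A distribution that lives on a countable set is a pmf.
\<close>

lemma (in prob_space) has_pmf_exists:
  assumes V: "random_vector A X \<in> M \<rightarrow>\<^sub>M count_space UNIV"
    and S: "countable S" and AE: "AE \<omega> in M. random_vector A X \<omega> \<in> S"
  obtains f where "has_pmf M A X f" "set_pmf f \<subseteq> S"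
proof -
  let ?N = "distr M (count_space UNIV) (random_vector A X)"
  interpret N: prob_space ?N using V by (rule prob_space_distr)
  have AE_N: "AE x in ?N. x \<in> S"
    using V AE by (subst AE_distr_iff) auto
  then have "AE x in ?N. measure ?N {x} \<noteq> 0"
    using S by (subst N.AE_support_countable) auto
  then have eq: "measure_pmf (Abs_pmf ?N) = ?N"
    using N.prob_space_axioms by (intro Abs_pmf_inverse) simp
  then have "has_pmf M A X (Abs_pmf ?N)" using V by (simp add: has_pmf_def)
  moreover have "AE x in measure_pmf (Abs_pmf ?N). x \<in> S"
    using AE_N by (simp only: eq)
  then have "set_pmf (Abs_pmf ?N) \<subseteq> S"
    by (auto simp: AE_measure_pmf_iff)
  ultimately show thesis by (rule that)
qed

text \<open>
  Conditioning on the value \<open>x\<close> of \<open>I\<close> leaves a product of independent factors.  An exponent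
  is zero or one, so it may be moved out of the expectation.
\<close>

lemma (in prob_space) expectation_selected_product:
  fixes G :: "nat \<Rightarrow> (nat \<Rightarrow> nat) \<Rightarrow> complex"
  assumes I: "has_pmf M {1..D} I fI" "set_pmf fI \<subseteq> {1..D} \<rightarrow>\<^sub>E {0, 1}"
    and Y: "\<And>k. k \<in> {1..D} \<Longrightarrow> has_pmf M (\<Lambda> k) (Y k) (fY k)"
      "\<And>k. k \<in> {1..D} \<Longrightarrow> finite (set_pmf (fY k))"
    and indep: "indep_vars (\<lambda>_. count_space UNIV)
      (\<lambda>k. if k = 0 then random_vector {1..D} I else random_vector (\<Lambda> k) (Y k)) {0..D}"
  shows "(\<integral>\<omega>. (\<Prod>k\<in>{1..D}. G k (random_vector (\<Lambda> k) (Y k) \<omega>) ^ I k \<omega>) \<partial>M) =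
    (\<Sum>x\<in>{1..D} \<rightarrow>\<^sub>E {0, 1}. of_real (pmf fI x) *
      (\<Prod>k\<in>{1..D}. measure_pmf.expectation (fY k) (G k) ^ x k))"
proof -
  let ?S = "{1..D} \<rightarrow>\<^sub>E {0, 1::nat}"
  let ?Z = "\<lambda>k. if k = 0 then random_vector {1..D} I else random_vector (\<Lambda> k) (Y k)"
  have S: "finite ?S" by (intro finite_PiE) auto
  \<comment> \<open>The factor of index zero selects the event that \<open>I\<close> takes the value \<open>x\<close>.\<close>
  define g where "g x k = (if k = 0 then indicator {x} else (\<lambda>v. G k v ^ x k))"
    for x :: "nat \<Rightarrow> nat" and k :: nat
  have ind: "indep_vars (\<lambda>_. borel) (\<lambda>k \<omega>. g x k (?Z k \<omega>)) {0..D}" for x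
    by (rule indep_vars_compose2[OF indep]) simp
  have int: "integrable M (\<lambda>\<omega>. g x k (?Z k \<omega>))" if k: "k \<in> {0..D}" for x k
  proof (cases "k = 0")
    case True
    have "finite (set_pmf fI)" using I(2) S by (rule finite_subset)
    then show ?thesis using has_pmf_integrable[OF I(1)] True by simp
  next
    case False
    then show ?thesis using has_pmf_integrable[OF Y(1)[of k] Y(2)[of k]] k by simp
  qed
  have split0: "(\<Prod>k\<in>{0..D}. h k) = h 0 * (\<Prod>k\<in>{1..D}. h k)" for h :: "nat \<Rightarrow> complex"
    using prod.atLeast_Suc_atMost[of 0 D h] by simp
  have "(\<integral>\<omega>. (\<Prod>k\<in>{1..D}. G k (random_vector (\<Lambda> k) (Y k) \<omega>) ^ I k \<omega>) \<partial>M) =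
      (\<integral>\<omega>. (\<Sum>x\<in>?S. \<Prod>k\<in>{0..D}. g x k (?Z k \<omega>)) \<partial>M)"
  proof (rule integral_cong_AE)
    have Zm: "?Z k \<in> M \<rightarrow>\<^sub>M count_space UNIV" if "k \<in> {0..D}" for k
      using indep that unfolding indep_vars_def by blast
    have Im: "I k \<in> M \<rightarrow>\<^sub>M count_space UNIV" if "k \<in> {1..D}" for k
      using has_pmf_component_measurable[OF I(1) that] .
    show "(\<lambda>\<omega>. \<Prod>k\<in>{1..D}. G k (random_vector (\<Lambda> k) (Y k) \<omega>) ^ I k \<omega>) \<in> borel_measurable M"
    proof (intro borel_measurable_prod)
      fix k assume k: "k \<in> {1..D}"
      have [measurable]: "I k \<in> M \<rightarrow>\<^sub>M count_space UNIV" by (rule Im[OF k])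
      have "random_vector (\<Lambda> k) (Y k) \<in> M \<rightarrow>\<^sub>M count_space UNIV" using Zm[of k] k by simp
      then have [measurable]: "(\<lambda>\<omega>. G k (random_vector (\<Lambda> k) (Y k) \<omega>)) \<in> borel_measurable M"
        by (rule measurable_compose) simp
      have "(\<lambda>\<omega>. (\<lambda>n \<omega>. G k (random_vector (\<Lambda> k) (Y k) \<omega>) ^ n) (I k \<omega>) \<omega>) \<in> borel_measurable M"
        by (rule measurable_compose_countable) measurable
      then show "(\<lambda>\<omega>. G k (random_vector (\<Lambda> k) (Y k) \<omega>) ^ I k \<omega>) \<in> borel_measurable M" by simp
    qed
    show "(\<lambda>\<omega>. \<Sum>x\<in>?S. \<Prod>k\<in>{0..D}. g x k (?Z k \<omega>)) \<in> borel_measurable M"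
      using int by (intro borel_measurable_sum borel_measurable_prod borel_measurable_integrable)
    have "AE \<omega> in M. random_vector {1..D} I \<omega> \<in> ?S"
      using has_pmf_AE[OF I(1), of "\<lambda>x. x \<in> ?S"] I(2) by blast
    then show "AE \<omega> in M. (\<Prod>k\<in>{1..D}. G k (random_vector (\<Lambda> k) (Y k) \<omega>) ^ I k \<omega>) =
        (\<Sum>x\<in>?S. \<Prod>k\<in>{0..D}. g x k (?Z k \<omega>))"
    proof eventually_elim
      fix \<omega> assume \<omega>: "random_vector {1..D} I \<omega> \<in> ?S"
      let ?x = "random_vector {1..D} I \<omega>"
      have "(\<Sum>x\<in>?S. \<Prod>k\<in>{0..D}. g x k (?Z k \<omega>)) = (\<Sum>x\<in>{?x}. \<Prod>k\<in>{0..D}. g x k (?Z k \<omega>))"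
        using S \<omega> by (intro sum.mono_neutral_right) (auto simp: g_def split0)
      also have "\<dots> = (\<Prod>k\<in>{1..D}. G k (random_vector (\<Lambda> k) (Y k) \<omega>) ^ ?x k)"
        by (simp add: split0 g_def)
      also have "\<dots> = (\<Prod>k\<in>{1..D}. G k (random_vector (\<Lambda> k) (Y k) \<omega>) ^ I k \<omega>)"
        by (intro prod.cong) (simp_all add: random_vector_def)
      finally show "(\<Prod>k\<in>{1..D}. G k (random_vector (\<Lambda> k) (Y k) \<omega>) ^ I k \<omega>) =
        (\<Sum>x\<in>?S. \<Prod>k\<in>{0..D}. g x k (?Z k \<omega>))" by simp
    qed
  qed
  also have "\<dots> = (\<Sum>x\<in>?S. \<integral>\<omega>. (\<Prod>k\<in>{0..D}. g x k (?Z k \<omega>)) \<partial>M)"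
    by (intro Bochner_Integration.integral_sum indep_vars_integrable[OF _ ind int]) auto
  also have "\<dots> = (\<Sum>x\<in>?S. \<Prod>k\<in>{0..D}. \<integral>\<omega>. g x k (?Z k \<omega>) \<partial>M)"
    by (intro sum.cong refl indep_vars_lebesgue_integral[OF _ ind int]) auto
  also have "\<dots> = (\<Sum>x\<in>?S. of_real (pmf fI x) *
      (\<Prod>k\<in>{1..D}. measure_pmf.expectation (fY k) (G k) ^ x k))"
  proof (rule sum.cong[OF refl])
    fix x assume x: "x \<in> ?S"
    have "(\<integral>\<omega>. g x 0 (?Z 0 \<omega>) \<partial>M) = measure_pmf.expectation fI (indicator {x})"
      using has_pmf_expectation[OF I(1), of "indicator {x}"] by (simp add: g_def)
    also have "\<dots> = of_real (pmf fI x)"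
      by (subst integral_measure_pmf[of "{x}"]) (auto simp: scaleR_conv_of_real indicator_def split: if_splits)
    finally have 0: "(\<integral>\<omega>. g x 0 (?Z 0 \<omega>) \<partial>M) = of_real (pmf fI x)" .
    have k: "(\<integral>\<omega>. g x k (?Z k \<omega>) \<partial>M) = measure_pmf.expectation (fY k) (G k) ^ x k"
      if k: "k \<in> {1..D}" for k
    proof -
      have "x k \<in> {0, 1}" using x k by (rule PiE_mem)
      moreover have "(\<integral>\<omega>. g x k (?Z k \<omega>) \<partial>M) = measure_pmf.expectation (fY k) (\<lambda>v. G k v ^ x k)"
        using has_pmf_expectation[OF Y(1)[OF k], of "\<lambda>v. G k v ^ x k"] k by (simp add: g_def)
      ultimately show ?thesis by auto
    qed
    show "(\<Prod>k\<in>{0..D}. \<integral>\<omega>. g x k (?Z k \<omega>) \<partial>M) =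
        of_real (pmf fI x) * (\<Prod>k\<in>{1..D}. measure_pmf.expectation (fY k) (G k) ^ x k)"
      unfolding split0 0 using k by (auto intro!: arg_cong[where f = "(*) _"] prod.cong simp del: if_distrib)
  qed
  finally show ?thesis .
qed

section \<open>Blocks selected by the maximum entropy vector\<close>

theorem proposition4p5:
  fixes M :: "'w measure"
    and d D :: nat
    and p :: "nat \<Rightarrow> real"
    and \<Lambda> :: "nat \<Rightarrow> nat set"
    and l :: "nat \<Rightarrow> nat"
    and pt :: "nat \<Rightarrow> real"
    and K :: "nat \<Rightarrow> nat \<Rightarrow> 'w \<Rightarrow> nat"
    and IH :: "nat \<Rightarrow> 'w \<Rightarrow> nat"
    and J :: "nat \<Rightarrow> 'w \<Rightarrow> nat"
    and fK :: "nat \<Rightarrow> (nat \<Rightarrow> nat) pmf"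
    and fI :: "(nat \<Rightarrow> nat) pmf"
  assumes "prob_space M"
    and "\<And>j. j \<in> {1..d} \<Longrightarrow> 0 < p j \<and> p j < 1"
    and "disjoint_family_on \<Lambda> {1..D}"
    and "(\<Union>h\<in>{1..D}. \<Lambda> h) = {1..d}"
    and "\<And>h. h \<in> {1..D} \<Longrightarrow> \<Lambda> h \<noteq> {}"
    and "\<And>h. h \<in> {1..D} \<Longrightarrow> card (\<Lambda> h) = l h"
    and "\<And>h j. h \<in> {1..D} \<Longrightarrow> j \<in> \<Lambda> h \<Longrightarrow> p j = pt h \<and> pt h \<le> 1 / real (l h)"
    and "\<And>h. h \<in> {1..D} \<Longrightarrow> has_pmf M (\<Lambda> h) (K h) (fK h)"
    and "\<And>h. h \<in> {1..D} \<Longrightarrow> is_lower_frechet_bound (\<Lambda> h) (\<lambda>_. 1 / real (l h)) (fK h)"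
    and "has_pmf M {1..D} IH fI"
    and "is_arg_max (pmf_entropy {1..D})
           (\<lambda>f. f \<in> sigma_frechet_class {1..D} (\<lambda>h. real (l h) * pt h)) fI"
    and "prob_space.indep_vars M (\<lambda>_. count_space UNIV)
           (\<lambda>k. if k = 0 then random_vector {1..D} IH else random_vector (\<Lambda> k) (K k)) {0..D}"
    and "\<And>h j \<omega>. h \<in> {1..D} \<Longrightarrow> j \<in> \<Lambda> h \<Longrightarrow> \<omega> \<in> space M \<Longrightarrow> J j \<omega> = IH h \<omega> * K h j \<omega>"
  shows "(\<exists>f \<in> frechet_class {1..d} p. has_pmf M {1..d} J f) \<and>
         strongly_rayleigh M {1..d} J \<and>
         sigma_countermonotonic M {1..d} J"
proof -
  interpret prob_space M by fact
  note p = assms(2) and disj = assms(3) and Un = assms(4) and ne = assms(5)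
    and l = assms(6) and pt = assms(7) and K = assms(8) and K_low = assms(9)
    and I = assms(10) and max = assms(11) and indep = assms(12) and J = assms(13)
  have fin: "finite (\<Lambda> h)" if "h \<in> {1..D}" for h
    using Un that by (metis UN_upper finite_atLeastAtMost finite_subset)
  have block: "\<exists>h\<in>{1..D}. j \<in> \<Lambda> h" if "j \<in> {1..d}" for j
    using Un that by blast
  have low: "is_lower_frechet_bound (\<Lambda> h) (\<lambda>_. 1 / real (card (\<Lambda> h))) (fK h)"
    if "h \<in> {1..D}" for h
    using K_low[OF that] l[OF that] by simp
  have K_sub: "set_pmf (fK h) \<subseteq> \<Lambda> h \<rightarrow>\<^sub>E {0, 1}"
    and K_marg: "\<And>j. j \<in> \<Lambda> h \<Longrightarrow> measure_pmf.prob (fK h) {x. x j = 1} = 1 / real (l h)"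
    if "h \<in> {1..D}" for h
    using K_low[OF that] by (auto simp: is_lower_frechet_bound_def frechet_class_iff)
  have I_class: "fI \<in> sigma_frechet_class {1..D} (\<lambda>h. real (l h) * pt h)"
    using max by (simp add: is_arg_max_def)
  then have I_sub: "set_pmf fI \<subseteq> {1..D} \<rightarrow>\<^sub>E {0, 1}"
    and I_marg: "\<And>h. h \<in> {1..D} \<Longrightarrow> measure_pmf.prob fI {x. x h = 1} = real (l h) * pt h"
    by (auto simp: sigma_frechet_class_def frechet_class_iff)
  have fin_K: "finite (set_pmf (fK h))" if "h \<in> {1..D}" for h
    using finite_subset[OF K_sub[OF that] finite_PiE[OF fin[OF that]]] by simp
  have l_pos: "l h > 0" if "h \<in> {1..D}" for h
    using l[OF that] ne[OF that] fin[OF that] by (metis card_gt_0_iff)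

  have J_meas: "J j \<in> M \<rightarrow>\<^sub>M count_space UNIV" if j: "j \<in> {1..d}" for j
  proof -
    obtain h where h: "h \<in> {1..D}" "j \<in> \<Lambda> h" using block[OF j] by blast
    have [measurable]: "IH h \<in> M \<rightarrow>\<^sub>M count_space UNIV" "K h j \<in> M \<rightarrow>\<^sub>M count_space UNIV"
      using has_pmf_component_measurable[OF I h(1)] has_pmf_component_measurable[OF K[OF h(1)] h(2)] .
    have "(\<lambda>\<omega>. IH h \<omega> * K h j \<omega>) \<in> M \<rightarrow>\<^sub>M count_space UNIV"
      by measurable
    then show ?thesis
      using J[OF h] by (subst measurable_cong) auto
  qed
  have JV: "random_vector {1..d} J \<in> M \<rightarrow>\<^sub>M count_space UNIV"
    using J_meas by (intro random_vector_measurable) auto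

  have AE_K: "AE \<omega> in M. \<forall>h\<in>{1..D}. (\<forall>j\<in>\<Lambda> h. K h j \<omega> \<in> {0, 1}) \<and> (\<Sum>j\<in>\<Lambda> h. K h j \<omega>) = 1"
  proof (rule AE_finite_allI)
    fix h assume h: "h \<in> {1..D}"
    have "AE \<omega> in M. (\<forall>j\<in>\<Lambda> h. random_vector (\<Lambda> h) (K h) \<omega> j \<in> {0, 1}) \<and>
        (\<Sum>j\<in>\<Lambda> h. random_vector (\<Lambda> h) (K h) \<omega> j) = 1"
      using lower_frechet_bound_one_hot[OF fin[OF h] ne[OF h] low[OF h]]
        binary_support_cases[OF K_sub[OF h]]
      by (intro has_pmf_AE[OF K[OF h], of "\<lambda>x. (\<forall>j\<in>\<Lambda> h. x j \<in> {0, 1}) \<and> (\<Sum>j\<in>\<Lambda> h. x j) = 1"] conjI ballI)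
    then show "AE \<omega> in M. (\<forall>j\<in>\<Lambda> h. K h j \<omega> \<in> {0, 1}) \<and> (\<Sum>j\<in>\<Lambda> h. K h j \<omega>) = 1"
      by (simp only: sum_random_vector random_vector_apply cong: ball_cong)
  qed simp
  obtain k where k: "\<And>x. x \<in> set_pmf fI \<Longrightarrow> (\<Sum>h\<in>{1..D}. x h) \<in> {k, Suc k}"
    using consecutive_sums_if_sigma_countermonotonic[OF _ I_class] by auto
  have AE_I: "AE \<omega> in M. (\<forall>h\<in>{1..D}. IH h \<omega> \<in> {0, 1}) \<and> (\<Sum>h\<in>{1..D}. IH h \<omega>) \<in> {k, Suc k}"
  proof -
    have "AE \<omega> in M. (\<forall>h\<in>{1..D}. random_vector {1..D} IH \<omega> h \<in> {0, 1}) \<and>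
        (\<Sum>h\<in>{1..D}. random_vector {1..D} IH \<omega> h) \<in> {k, Suc k}"
      using k binary_support_cases[OF I_sub]
      by (intro has_pmf_AE[OF I, of "\<lambda>x. (\<forall>h\<in>{1..D}. x h \<in> {0, 1}) \<and> (\<Sum>h\<in>{1..D}. x h) \<in> {k, Suc k}"] conjI ballI)
    then show ?thesis
      by (simp only: sum_random_vector random_vector_apply cong: ball_cong)
  qed

  have prob_J: "prob {\<omega> \<in> space M. J j \<omega> = 1} = p j" if j: "j \<in> {1..d}" for j
  proof -
    obtain h where h: "h \<in> {1..D}" "j \<in> \<Lambda> h" using block[OF j] by blast
    let ?Z = "\<lambda>k. if k = 0 then random_vector {1..D} IH else random_vector (\<Lambda> k) (K k)"
    let ?A = "\<lambda>k. if k = 0 then {x. x h = 1} else {x. x j = 1}"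
    have h0: "h \<noteq> 0" using h by simp
    have "{\<omega> \<in> space M. J j \<omega> = 1} = (\<Inter>k\<in>{0, h}. ?Z k -` ?A k \<inter> space M)"
      using h h0 J[OF h] by (auto simp: random_vector_def)
    then have "prob {\<omega> \<in> space M. J j \<omega> = 1} = (\<Prod>k\<in>{0, h}. prob (?Z k -` ?A k \<inter> space M))"
      using indep_varsD[OF indep, of "{0, h}" ?A] h by simp
    also have "\<dots> = prob {\<omega> \<in> space M. random_vector {1..D} IH \<omega> \<in> {x. x h = 1}} *
        prob {\<omega> \<in> space M. random_vector (\<Lambda> h) (K h) \<omega> \<in> {x. x j = 1}}"
      using h0 by (simp add: vimage_def Int_def conj_commute)
    also have "\<dots> = (real (l h) * pt h) * (1 / real (l h))"
      unfolding has_pmf_prob[OF I] has_pmf_prob[OF K[OF h(1)]] I_marg[OF h(1)] K_marg[OF h] ..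
    also have "\<dots> = p j"
      using l_pos[OF h(1)] pt[OF h] by simp
    finally show ?thesis .
  qed

  have law: "\<exists>f \<in> frechet_class {1..d} p. has_pmf M {1..d} J f"
  proof -
    have "AE \<omega> in M. random_vector {1..d} J \<omega> \<in> {1..d} \<rightarrow>\<^sub>E {0, 1}"
      using AE_K AE_I AE_space
    proof eventually_elim
      case (elim \<omega>)
      have "J j \<omega> \<in> {0, 1}" if j: "j \<in> {1..d}" for j
      proof -
        obtain h where h: "h \<in> {1..D}" "j \<in> \<Lambda> h" using block[OF j] by blast
        then have "IH h \<omega> \<in> {0, 1}" "K h j \<omega> \<in> {0, 1}" using elim by blast+
        then show ?thesis using J[OF h elim(3)] by auto
      qed
      then show ?case unfolding random_vector_def by (rule restrict_PiE_iff[THEN iffD2, rule_format])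
    qed
    moreover have "countable ({1..d} \<rightarrow>\<^sub>E {0, 1::nat})"
      by (intro countable_finite finite_PiE) auto
    ultimately obtain f where f: "has_pmf M {1..d} J f" "set_pmf f \<subseteq> {1..d} \<rightarrow>\<^sub>E {0, 1}"
      using has_pmf_exists[OF JV] by metis
    have "measure_pmf.prob f {x. x j = 1} = p j" if j: "j \<in> {1..d}" for j
      using has_pmf_prob[OF f(1), of "{x. x j = 1}"] prob_J[OF j] j by (simp add: random_vector_def)
    then have "f \<in> frechet_class {1..d} p"
      using f(2) p by (auto simp: frechet_class_iff less_imp_le)
    then show ?thesis using f(1) by blast
  qed

  have "strongly_rayleigh M {1..d} J"
    unfolding strongly_rayleigh_def
  proof (intro allI impI)
    fix z :: "nat \<Rightarrow> complex" assume z: "\<forall>j\<in>{1..d}. Im (z j) > 0"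
    \<comment> \<open>The variables of a block enter the generating function only through their mean.\<close>
    define m where "m h = (\<Sum>j\<in>\<Lambda> h. z j) / of_nat (card (\<Lambda> h))" for h
    have m: "Im (m h) > 0" if h: "h \<in> {1..D}" for h
    proof -
      have "(\<Sum>j\<in>\<Lambda> h. Im (z j)) > 0"
        using z h Un fin[OF h] ne[OF h] by (intro sum_pos) auto
      then show ?thesis
        using l_pos[OF h] l[OF h] by (simp add: m_def)
    qed
    define G :: "nat \<Rightarrow> (nat \<Rightarrow> nat) \<Rightarrow> complex"
      where "G h = (\<lambda>v. \<Prod>j\<in>\<Lambda> h. z j ^ v j)" for h
    have "pgf M {1..d} J z =
        (\<integral>\<omega>. (\<Prod>h\<in>{1..D}. G h (random_vector (\<Lambda> h) (K h) \<omega>) ^ IH h \<omega>) \<partial>M)"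
      unfolding pgf_def
    proof (rule Bochner_Integration.integral_cong[OF refl])
      fix \<omega> assume \<omega>: "\<omega> \<in> space M"
      have "(\<Prod>j\<in>{1..d}. z j ^ J j \<omega>) = (\<Prod>h\<in>{1..D}. \<Prod>j\<in>\<Lambda> h. z j ^ J j \<omega>)"
        unfolding Un[symmetric] using fin disj
        by (intro prod.UNION_disjoint) (auto simp: disjoint_family_on_def)
      also have "\<dots> = (\<Prod>h\<in>{1..D}. G h (random_vector (\<Lambda> h) (K h) \<omega>) ^ IH h \<omega>)"
      proof (rule prod.cong[OF refl])
        fix h assume h: "h \<in> {1..D}"
        show "(\<Prod>j\<in>\<Lambda> h. z j ^ J j \<omega>) = G h (random_vector (\<Lambda> h) (K h) \<omega>) ^ IH h \<omega>"
          unfolding G_def prod_power_distrib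
          by (intro prod.cong) (simp_all add: J[OF h _ \<omega>] random_vector_def mult.commute flip: power_mult)
      qed
      finally show "(\<Prod>j\<in>{1..d}. z j ^ J j \<omega>) =
          (\<Prod>h\<in>{1..D}. G h (random_vector (\<Lambda> h) (K h) \<omega>) ^ IH h \<omega>)" .
    qed
    also have "\<dots> = (\<Sum>x\<in>{1..D} \<rightarrow>\<^sub>E {0, 1}. of_real (pmf fI x) *
        (\<Prod>h\<in>{1..D}. measure_pmf.expectation (fK h) (G h) ^ x h))"
      by (rule expectation_selected_product[OF I I_sub K fin_K indep])
    also have "\<dots> = (\<Sum>x\<in>{1..D} \<rightarrow>\<^sub>E {0, 1}. of_real (pmf fI x) * (\<Prod>h\<in>{1..D}. m h ^ x h))"
    proof -
      have "measure_pmf.expectation (fK h) (G h) = m h" if "h \<in> {1..D}" for h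
        using lower_frechet_bound_pgf[OF fin[OF that] ne[OF that] low[OF that], of z]
        by (simp add: G_def m_def)
      then show ?thesis by simp
    qed
    also have "\<dots> \<noteq> 0"
      by (rule max_entropy_pgf_nonzero[OF _ max m]) simp_all
    finally show "pgf M {1..d} J z \<noteq> 0" .
  qed
  moreover have "sigma_countermonotonic M {1..d} J"
  proof (rule sigma_countermonotonic_if_consecutive_sums)
    show "AE \<omega> in M. (\<Sum>j\<in>{1..d}. J j \<omega>) \<in> {k, Suc k}"
      using AE_K AE_I AE_space
    proof eventually_elim
      case (elim \<omega>)
      have "(\<Sum>j\<in>{1..d}. J j \<omega>) = (\<Sum>h\<in>{1..D}. \<Sum>j\<in>\<Lambda> h. J j \<omega>)"
        unfolding Un[symmetric] using fin disj
        by (intro sum.UNION_disjoint) (auto simp: disjoint_family_on_def)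
      also have "\<dots> = (\<Sum>h\<in>{1..D}. IH h \<omega>)"
      proof (rule sum.cong[OF refl])
        fix h assume h: "h \<in> {1..D}"
        have "(\<Sum>j\<in>\<Lambda> h. J j \<omega>) = IH h \<omega> * (\<Sum>j\<in>\<Lambda> h. K h j \<omega>)"
          unfolding sum_distrib_left using J[OF h _ elim(3)] by (intro sum.cong) auto
        then show "(\<Sum>j\<in>\<Lambda> h. J j \<omega>) = IH h \<omega>" using elim(1) h by simp
      qed
      finally show ?case using elim(2) by simp
    qed
  qed (simp_all add: prob_space_axioms)
  ultimately show ?thesis using law by blast
qed

end
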